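(* Let $m\ge 1$ and let $(\alpha_0^{(1)},\ldots,\alpha_0^{(m)})\in\mathbb{Q}_p^m$ have a purely periodic multidimensional continued fraction of period $N=1$. Then its characteristic polynomial does not have any rational root. In particular, when $m=2$ the characteristic polynomial is irreducible over $\mathbb{Q}$, and the limits $\alpha_0^{(1)},\alpha_0^{(2)}$ of the multidimensional continued fraction generate a cubic field, i.e. $[\mathbb{Q}(\alpha_0^{(1)},\alpha_0^{(2)}):\mathbb{Q}]=3$.
   Context: Let $p$ be an odd prime. Every $\alpha\in\mathbb{Q}_p$ can be written uniquely as $\alpha=\sum_{j=k}^{\infty}x_jp^j$ with $k\in\mathbb{Z}$ and $x_j\in\mathbb{Z}\cap(-\frac p2,\frac p2)$. The Browkin $s$-function is $s(\alpha)=\sum_{j=k}^{0}x_jp^j$ (the sum of the terms with $j\le 0$; it is $0$ if there are none). $p$-adic Jacobi--Perron algorithm of dimension $m$: on input $\bm{\alpha}_0=(\alpha_0^{(1)},\ldots,\alpha_0^{(m)})\in\mathbb{Q}_p^m$, for $n=0,1,2,\ldots$ put $a_n^{(i)}=s(\alpha_n^{(i)})$ for $i=1,\ldots,m$ (partial quotients). If $\alpha_n^{(m)}=a_n^{(m)}$ the algorithm stops; otherwise set $\alpha_{n+1}^{(1)}=\dfrac{1}{\alpha_n^{(m)}-a_n^{(m)}}$ and $\alpha_{n+1}^{(i)}=\dfrac{\alpha_n^{(i-1)}-a_n^{(i-1)}}{\alpha_n^{(m)}-a_n^{(m)}}$ for $i=2,\ldots,m$, and continue. The sequences of partial quotients form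 the multidimensional continued fraction (MCF) of $\bm{\alpha}_0$. The MCF is purely periodic of period $N$ if the algorithm does not stop and $a_{k+N}^{(i)}=a_k^{(i)}$ for all $k\ge 0$ and $i=1,\ldots,m$. For period $N=1$ (so $a_k^{(i)}=a_0^{(i)}$ for all $k$), the characteristic polynomial of the MCF is the characteristic polynomial of the $(m+1)\times(m+1)$ matrix $$\mathcal{A}_0=\begin{pmatrix} a_0^{(1)}&1&0&\ldots&0\\ a_0^{(2)}&0&1&\ldots&0\\ \vdots&\vdots&\vdots&\vdots&\vdots\\ a_0^{(m)}&0&0&\ldots&1\\ 1&0&0&\ldots&0\end{pmatrix}.$$ *)

theory Defs
  imports
    Complex_Main
    "Jordan_Normal_Form.Char_Poly"
    "Berlekamp_Zassenhaus.Finite_Field"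
begin

definition padic_abs :: "nat \<Rightarrow> rat \<Rightarrow> real" where
  "padic_abs p q = (if q = 0 then 0 else
     real p powi (int (multiplicity (int p) (snd (quotient_of q)))
                  - int (multiplicity (int p) (fst (quotient_of q)))))"

lemma padic_abs_0 [simp]: "padic_abs p 0 = 0"
  by (simp add: padic_abs_def)

context
  fixes p :: nat
  assumes p: "prime p"
begin

lemma padic_abs_divide_int:
  assumes "a \<noteq> 0" "b \<noteq> 0"
  shows "padic_abs p (of_int a / of_int b)
    = real p powi (int (multiplicity (int p) b) - int (multiplicity (int p) a))"
proof -
  obtain c d where cd: "quotient_of (of_int a / of_int b) = (c, d)"
    by fastforce
  have d: "d > 0" and eq: "(of_int a / of_int b :: rat) = of_int c / of_int d"
    using quotient_of_denom_pos[OF cd] quotient_of_div[OF cd] by auto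
  have c: "c \<noteq> 0"
    using eq assms d by auto
  have "(of_int (a * d) :: rat) = of_int (c * b)"
    using eq assms d by (simp add: field_simps)
  hence "a * d = c * b"
    by (simp only: of_int_eq_iff)
  hence "multiplicity (int p) (a * d) = multiplicity (int p) (c * b)"
    by simp
  hence "multiplicity (int p) a + multiplicity (int p) d
      = multiplicity (int p) c + multiplicity (int p) b"
    using assms c d p by (simp add: prime_elem_multiplicity_mult_distrib)
  thus ?thesis
    using assms by (simp add: padic_abs_def cd) (rule arg_cong2[where f = "power_int"]; simp)
qed

lemma rat_cases2:
  fixes q r :: rat
  obtains a b d where "d \<noteq> 0" "q = of_int a / of_int d" "r = of_int b / of_int d"
proof -
  obtain a d where 1: "q = of_int a / of_int d" "d > 0"
    by (metis quotient_of_denom_pos' quotient_of_div surj_pair snd_conv)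
  obtain b e where 2: "r = of_int b / of_int e" "e > 0"
    by (metis quotient_of_denom_pos' quotient_of_div surj_pair snd_conv)
  show ?thesis
    by (rule that[of "d * e" "a * e" "b * d"]) (use 1 2 in \<open>auto simp: field_simps\<close>)
qed

lemma padic_abs_pos: "q \<noteq> 0 \<Longrightarrow> padic_abs p q > 0"
  using prime_gt_0_nat[OF p] by (simp add: padic_abs_def zero_less_power_int)

lemma padic_abs_nonneg [simp]: "padic_abs p q \<ge> 0"
  using padic_abs_pos[of q] by (cases "q = 0") auto

lemma padic_abs_eq_0_iff [simp]: "padic_abs p q = 0 \<longleftrightarrow> q = 0"
  using padic_abs_pos[of q] by (cases "q = 0") auto

lemma padic_abs_mult: "padic_abs p (q * r) = padic_abs p q * padic_abs p r"
proof (cases "q = 0 \<or> r = 0")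
  case False
  obtain a b d where *: "d \<noteq> 0" "q = of_int a / of_int d" "r = of_int b / of_int d"
    by (rule rat_cases2)
  have ab: "a \<noteq> 0" "b \<noteq> 0"
    using False * by auto
  have "q * r = of_int (a * b) / of_int (d * d)"
    using * by simp
  also have "padic_abs p \<dots> = real p powi (int (multiplicity (int p) (d * d))
      - int (multiplicity (int p) (a * b)))"
    using * ab by (intro padic_abs_divide_int) auto
  also have "\<dots> = real p powi ((int (multiplicity (int p) d) - int (multiplicity (int p) a))
      + (int (multiplicity (int p) d) - int (multiplicity (int p) b)))"
    using * ab p by (simp add: prime_elem_multiplicity_mult_distrib algebra_simps)
  also have "\<dots> = padic_abs p q * padic_abs p r"
    using * ab prime_gt_0_nat[OF p] by (subst power_int_add) (auto simp: padic_abs_divide_int)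
  finally show ?thesis .
qed auto

lemma padic_abs_1 [simp]: "padic_abs p 1 = 1"
  using padic_abs_divide_int[of 1 1] by simp

lemma padic_abs_minus [simp]: "padic_abs p (- q) = padic_abs p q"
proof -
  have "padic_abs p (- 1) = 1"
    using padic_abs_divide_int[of "-1" 1] by (simp add: multiplicity_unit_right)
  thus ?thesis
    using padic_abs_mult[of "-1" q] by simp
qed

lemma padic_abs_diff_commute: "padic_abs p (q - r) = padic_abs p (r - q)"
  using padic_abs_minus[of "q - r"] by simp

lemma padic_abs_inverse: "padic_abs p (inverse q) = inverse (padic_abs p q)"
proof (cases "q = 0")
  case False
  hence "padic_abs p q * padic_abs p (inverse q) = 1"
    by (simp flip: padic_abs_mult)
  thus ?thesis
    by (metis inverse_unique)
qed simp

lemma padic_abs_add: "padic_abs p (q + r) \<le> max (padic_abs p q) (padic_abs p r)"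
proof (cases "q = 0 \<or> r = 0 \<or> q + r = 0")
  case False
  obtain a b d where *: "d \<noteq> 0" "q = of_int a / of_int d" "r = of_int b / of_int d"
    by (rule rat_cases2)
  have qr: "q + r = of_int (a + b) / of_int d"
    using * by (simp add: field_simps)
  have nz: "a \<noteq> 0" "b \<noteq> 0" "a + b \<noteq> 0"
    using False * qr by auto
  define k where "k = min (multiplicity (int p) a) (multiplicity (int p) b)"
  have "int p ^ k dvd a" "int p ^ k dvd b"
    by (auto simp: k_def intro: multiplicity_dvd')
  hence "int p ^ k dvd a + b"
    by simp
  hence "k \<le> multiplicity (int p) (a + b)"
    using nz p prime_gt_1_nat[OF p] by (intro multiplicity_geI) auto
  moreover have "padic_abs p (q + r)
      = real p powi (int (multiplicity (int p) d) - int (multiplicity (int p) (a + b)))"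
    unfolding qr using nz * by (intro padic_abs_divide_int) auto
  ultimately have "padic_abs p (q + r) \<le> real p powi (int (multiplicity (int p) d) - int k)"
    using prime_gt_1_nat[OF p] by (simp add: power_int_increasing)
  also have "\<dots> \<le> max (padic_abs p q) (padic_abs p r)"
    using * nz by (auto simp: k_def min_def le_max_iff_disj padic_abs_divide_int)
  finally show ?thesis .
qed (auto simp: le_max_iff_disj)

lemma padic_abs_diff: "padic_abs p (q - r) \<le> max (padic_abs p q) (padic_abs p r)"
  using padic_abs_add[of q "- r"] by simp

lemma padic_abs_triangle: "padic_abs p (q + r) \<le> padic_abs p q + padic_abs p r"
  using padic_abs_add[of q r] padic_abs_nonneg[of q] padic_abs_nonneg[of r] by linarith

lemma padic_abs_triangle_diff: "\<bar>padic_abs p q - padic_abs p r\<bar> \<le> padic_abs p (q - r)"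
  using padic_abs_triangle[of "q - r" r] padic_abs_triangle[of "r - q" q]
    padic_abs_diff_commute[of q r] by simp

end


definition padic_Cauchy :: "nat \<Rightarrow> (nat \<Rightarrow> rat) \<Rightarrow> bool" where
  "padic_Cauchy p X \<longleftrightarrow> (\<forall>e>0. \<exists>M. \<forall>m\<ge>M. \<forall>n\<ge>M. padic_abs p (X m - X n) < e)"

definition padic_null :: "nat \<Rightarrow> (nat \<Rightarrow> rat) \<Rightarrow> bool" where
  "padic_null p X \<longleftrightarrow> (\<lambda>n. padic_abs p (X n)) \<longlonglongrightarrow> 0"

context
  fixes p :: nat
  assumes p: "prime p"
begin

lemma padic_null_bound:
  assumes "Y \<longlonglongrightarrow> 0" "eventually (\<lambda>n. padic_abs p (X n) \<le> Y n) sequentially"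
  shows "padic_null p X"
  unfolding padic_null_def
  by (rule tendsto_sandwich[OF _ assms(2) tendsto_const assms(1)]) (simp add: p)

lemma padic_null_0 [simp]: "padic_null p (\<lambda>_. 0)"
  by (simp add: padic_null_def)

lemma padic_null_add:
  assumes "padic_null p X" "padic_null p Y"
  shows "padic_null p (\<lambda>n. X n + Y n)"
  using tendsto_add[OF assms[unfolded padic_null_def]]
  by (intro padic_null_bound) (auto simp: padic_abs_triangle p)

lemma padic_null_minus [simp]: "padic_null p (\<lambda>n. - X n) \<longleftrightarrow> padic_null p X"
  by (simp add: padic_null_def padic_abs_minus p)

lemma padic_null_diff:
  assumes "padic_null p X" "padic_null p Y"
  shows "padic_null p (\<lambda>n. X n - Y n)"
  using padic_null_add[of X "\<lambda>n. - Y n"] assms by simp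

lemma padic_Cauchy_const [simp]: "padic_Cauchy p (\<lambda>_. q)"
  by (simp add: padic_Cauchy_def)

lemma padic_Cauchy_minus: "padic_Cauchy p X \<Longrightarrow> padic_Cauchy p (\<lambda>n. - X n)"
  by (simp add: padic_Cauchy_def padic_abs_diff_commute p)

lemma padic_Cauchy_add:
  assumes "padic_Cauchy p X" "padic_Cauchy p Y"
  shows "padic_Cauchy p (\<lambda>n. X n + Y n)"
  unfolding padic_Cauchy_def
proof safe
  fix e :: real assume e: "e > 0"
  obtain M M' where M: "\<And>m n. m \<ge> M \<Longrightarrow> n \<ge> M \<Longrightarrow> padic_abs p (X m - X n) < e"
    and M': "\<And>m n. m \<ge> M' \<Longrightarrow> n \<ge> M' \<Longrightarrow> padic_abs p (Y m - Y n) < e"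
    using assms e unfolding padic_Cauchy_def by metis
  have "padic_abs p (X m + Y m - (X n + Y n)) < e" if "m \<ge> max M M'" "n \<ge> max M M'" for m n
  proof -
    have eq: "X m + Y m - (X n + Y n) = (X m - X n) + (Y m - Y n)"
      by simp
    show ?thesis
      unfolding eq
      using padic_abs_add[OF p, of "X m - X n" "Y m - Y n"] M[of m n] M'[of m n] that
      by auto
  qed
  thus "\<exists>M. \<forall>m\<ge>M. \<forall>n\<ge>M. padic_abs p (X m + Y m - (X n + Y n)) < e"
    by blast
qed

lemma padic_Cauchy_diff:
  assumes "padic_Cauchy p X" "padic_Cauchy p Y"
  shows "padic_Cauchy p (\<lambda>n. X n - Y n)"
  using padic_Cauchy_add[OF assms(1) padic_Cauchy_minus[OF assms(2)]] by simp

lemma padic_abs_convergent: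
  assumes "padic_Cauchy p X"
  shows "convergent (\<lambda>n. padic_abs p (X n))"
proof -
  have "Cauchy (\<lambda>n. padic_abs p (X n))"
    unfolding Cauchy_def dist_real_def
    using assms le_less_trans[OF padic_abs_triangle_diff[OF p]]
    unfolding padic_Cauchy_def by metis
  thus ?thesis
    by (rule Cauchy_convergent)
qed

lemma padic_Cauchy_bounded:
  assumes "padic_Cauchy p X"
  obtains B where "B > 0" "\<And>n. padic_abs p (X n) \<le> B"
proof -
  obtain B where B: "B > 0" "\<And>n. norm (padic_abs p (X n)) \<le> B"
    using convergent_imp_Bseq[OF padic_abs_convergent[OF assms]] unfolding Bseq_def by blast
  thus ?thesis
    using that[of B] B by (simp add: p)
qed

lemma padic_null_mult_bounded:
  assumes "padic_null p X" "\<And>n. padic_abs p (Y n) \<le> B"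
  shows "padic_null p (\<lambda>n. X n * Y n)"
proof (rule padic_null_bound)
  show "(\<lambda>n. padic_abs p (X n) * B) \<longlonglongrightarrow> 0"
    using tendsto_mult_right[OF assms(1)[unfolded padic_null_def], of B] by simp
  show "\<forall>\<^sub>F n in sequentially. padic_abs p (X n * Y n) \<le> padic_abs p (X n) * B"
    using assms(2) by (simp add: padic_abs_mult p mult_left_mono)
qed

lemma padic_Cauchy_mult:
  assumes X: "padic_Cauchy p X" and Y: "padic_Cauchy p Y"
  shows "padic_Cauchy p (\<lambda>n. X n * Y n)"
  unfolding padic_Cauchy_def
proof safe
  fix e :: real assume e: "e > 0"
  obtain B where B: "B > 0" "\<And>n. padic_abs p (X n) \<le> B"
    using padic_Cauchy_bounded[OF X] by blast
  obtain C where C: "C > 0" "\<And>n. padic_abs p (Y n) \<le> C"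
    using padic_Cauchy_bounded[OF Y] by blast
  have "e / C > 0" "e / B > 0"
    using e B C by auto
  then obtain M M' where M: "\<And>m n. m \<ge> M \<Longrightarrow> n \<ge> M \<Longrightarrow> padic_abs p (X m - X n) < e / C"
    and M': "\<And>m n. m \<ge> M' \<Longrightarrow> n \<ge> M' \<Longrightarrow> padic_abs p (Y m - Y n) < e / B"
    using assms unfolding padic_Cauchy_def by metis
  have "padic_abs p (X m * Y m - X n * Y n) < e" if "m \<ge> max M M'" "n \<ge> max M M'" for m n
  proof -
    have "X m * Y m - X n * Y n = (X m - X n) * Y m + X n * (Y m - Y n)"
      by (simp add: algebra_simps)
    moreover have "padic_abs p ((X m - X n) * Y m) < e"
    proof -
      have "padic_abs p ((X m - X n) * Y m) \<le> padic_abs p (X m - X n) * C"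
        using C by (simp add: padic_abs_mult p mult_left_mono)
      also have "\<dots> < e"
        using M[of m n] that C by (simp add: field_simps)
      finally show ?thesis .
    qed
    moreover have "padic_abs p (X n * (Y m - Y n)) < e"
    proof -
      have "padic_abs p (X n * (Y m - Y n)) \<le> B * padic_abs p (Y m - Y n)"
        using B by (simp add: padic_abs_mult p mult_right_mono)
      also have "\<dots> < e"
        using M'[of m n] that B by (simp add: field_simps)
      finally show ?thesis .
    qed
    ultimately show ?thesis
      using padic_abs_add[OF p, of "(X m - X n) * Y m" "X n * (Y m - Y n)"] by simp
  qed
  thus "\<exists>M. \<forall>m\<ge>M. \<forall>n\<ge>M. padic_abs p (X m * Y m - X n * Y n) < e"
    by blast
qed

lemma padic_not_null_away:
  assumes X: "padic_Cauchy p X" and nn: "\<not> padic_null p X"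
  obtains b M where "b > 0" "\<And>n. n \<ge> M \<Longrightarrow> padic_abs p (X n) > b"
proof -
  obtain L where L: "(\<lambda>n. padic_abs p (X n)) \<longlonglongrightarrow> L"
    using padic_abs_convergent[OF X] by (auto simp: convergent_def)
  have "L \<ge> 0"
    by (rule LIMSEQ_le_const[OF L]) (simp add: p)
  with L nn have "L > 0"
    by (cases "L = 0") (auto simp: padic_null_def)
  hence "eventually (\<lambda>n. padic_abs p (X n) > L / 2) sequentially"
    by (intro order_tendstoD(1)[OF L]) auto
  thus ?thesis
    using that[of "L / 2"] \<open>L > 0\<close> by (auto simp: eventually_sequentially)
qed

lemma padic_abs_inverse_diff:
  assumes "x \<noteq> 0" "y \<noteq> 0"
  shows "padic_abs p (inverse x - inverse y)
       = padic_abs p (x - y) * (inverse (padic_abs p x) * inverse (padic_abs p y))"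
proof -
  have "inverse x - inverse y = (y - x) * (inverse x * inverse y)"
    using assms by (simp add: field_simps)
  thus ?thesis
    by (simp add: padic_abs_mult padic_abs_inverse p padic_abs_diff_commute[OF p, of x y])
qed

lemma padic_Cauchy_inverse:
  assumes X: "padic_Cauchy p X" and nn: "\<not> padic_null p X"
  shows "padic_Cauchy p (\<lambda>n. inverse (X n))"
  unfolding padic_Cauchy_def
proof safe
  fix e :: real assume e: "e > 0"
  obtain b M where b: "b > 0" and M: "\<And>n. n \<ge> M \<Longrightarrow> padic_abs p (X n) > b"
    using padic_not_null_away[OF X nn] by metis
  have "e * (b * b) > 0"
    using e b by simp
  then obtain M' where M': "\<And>m n. m \<ge> M' \<Longrightarrow> n \<ge> M' \<Longrightarrow> padic_abs p (X m - X n) < e * (b * b)"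
    using X unfolding padic_Cauchy_def by metis
  have "padic_abs p (inverse (X m) - inverse (X n)) < e"
    if "m \<ge> max M M'" "n \<ge> max M M'" for m n
  proof -
    have mn: "padic_abs p (X m) > b" "padic_abs p (X n) > b"
      using M that by auto
    hence nz: "X m \<noteq> 0" "X n \<noteq> 0"
      using b by auto
    have "inverse (padic_abs p (X m)) * inverse (padic_abs p (X n)) \<le> inverse b * inverse b"
      using mn b by (intro mult_mono le_imp_inverse_le) auto
    hence "padic_abs p (inverse (X m) - inverse (X n))
        \<le> padic_abs p (X m - X n) * (inverse b * inverse b)"
      unfolding padic_abs_inverse_diff[OF nz] by (intro mult_left_mono) (auto simp: p)
    also have "\<dots> < e"
      using M'[of m n] that b by (simp add: field_simps)
    finally show ?thesis .
  qed
  thus "\<exists>M. \<forall>m\<ge>M. \<forall>n\<ge>M. padic_abs p (inverse (X m) - inverse (X n)) < e"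
    by blast
qed

lemma padic_null_inverse_diff:
  assumes X: "padic_Cauchy p X" "\<not> padic_null p X"
    and Y: "padic_Cauchy p Y" "\<not> padic_null p Y"
    and XY: "padic_null p (\<lambda>n. X n - Y n)"
  shows "padic_null p (\<lambda>n. inverse (X n) - inverse (Y n))"
proof -
  obtain b M where b: "b > 0" and M: "\<And>n. n \<ge> M \<Longrightarrow> padic_abs p (X n) > b"
    using padic_not_null_away[OF X] by metis
  obtain c M' where c: "c > 0" and M': "\<And>n. n \<ge> M' \<Longrightarrow> padic_abs p (Y n) > c"
    using padic_not_null_away[OF Y] by metis
  show ?thesis
  proof (rule padic_null_bound)
    show "(\<lambda>n. padic_abs p (X n - Y n) * (inverse b * inverse c)) \<longlonglongrightarrow> 0"
      using tendsto_mult_right[OF XY[unfolded padic_null_def], of "inverse b * inverse c"] by simp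
    show "\<forall>\<^sub>F n in sequentially. padic_abs p (inverse (X n) - inverse (Y n))
            \<le> padic_abs p (X n - Y n) * (inverse b * inverse c)"
      using eventually_ge_at_top[of "max M M'"]
    proof eventually_elim
      case (elim n)
      have n: "padic_abs p (X n) > b" "padic_abs p (Y n) > c"
        using M M' elim by auto
      hence nz: "X n \<noteq> 0" "Y n \<noteq> 0"
        using b c by auto
      have "inverse (padic_abs p (X n)) * inverse (padic_abs p (Y n)) \<le> inverse b * inverse c"
        using n b c by (intro mult_mono le_imp_inverse_le) auto
      thus ?case
        unfolding padic_abs_inverse_diff[OF nz] by (intro mult_left_mono) (auto simp: p)
    qed
  qed
qed

end

text \<open>
  The prime \<open>p\<close> is the cardinality of the type argument \<open>'p\<close>. The type \<open>'p padic\<close> is the completion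
  of the rationals at \<open>p\<close>: the ring of \<open>p\<close>-adic Cauchy sequences modulo the null sequences. The
  constant \<open>norm\<close> is reserved for real normed vector spaces, so the absolute value is called
  \<open>padic_norm\<close>; \<open>dist\<close>, limits and sums refer to the metric that it induces.
\<close>

typedef (overloaded) 'p padic_seq = "{X. padic_Cauchy CARD('p::prime_card) X}"
  by (rule exI[of _ "\<lambda>_. 0"]) (simp add: prime_card)

setup_lifting type_definition_padic_seq

instantiation padic_seq :: (prime_card) comm_ring_1
begin

lift_definition zero_padic_seq :: "'a padic_seq" is "\<lambda>_. 0"
  by (simp add: prime_card)

lift_definition one_padic_seq :: "'a padic_seq" is "\<lambda>_. 1"
  by (simp add: prime_card)

lift_definition plus_padic_seq :: "'a padic_seq \<Rightarrow> 'a padic_seq \<Rightarrow> 'a padic_seq"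
  is "\<lambda>X Y n. X n + Y n"
  by (simp add: prime_card padic_Cauchy_add)

lift_definition uminus_padic_seq :: "'a padic_seq \<Rightarrow> 'a padic_seq" is "\<lambda>X n. - X n"
  by (simp add: prime_card padic_Cauchy_minus)

lift_definition minus_padic_seq :: "'a padic_seq \<Rightarrow> 'a padic_seq \<Rightarrow> 'a padic_seq"
  is "\<lambda>X Y n. X n - Y n"
  by (simp add: prime_card padic_Cauchy_diff)

lift_definition times_padic_seq :: "'a padic_seq \<Rightarrow> 'a padic_seq \<Rightarrow> 'a padic_seq"
  is "\<lambda>X Y n. X n * Y n"
  by (simp add: prime_card padic_Cauchy_mult)

instance
  by standard (transfer; force simp: algebra_simps fun_eq_iff)+

end

lift_definition padic_seq_null :: "'p::prime_card padic_seq \<Rightarrow> bool" is "padic_null CARD('p)" .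

lift_definition padic_seq_inverse :: "'p::prime_card padic_seq \<Rightarrow> 'p padic_seq"
  is "\<lambda>X. if padic_null CARD('p) X then (\<lambda>n. 0) else (\<lambda>n. inverse (X n))"
  by (simp add: prime_card padic_Cauchy_inverse)

lift_definition padic_seq_const :: "rat \<Rightarrow> 'p::prime_card padic_seq" is "\<lambda>q _. q"
  by (simp add: prime_card)


lift_definition padic_seq_norm :: "'p::prime_card padic_seq \<Rightarrow> real"
  is "\<lambda>X. lim (\<lambda>n. padic_abs CARD('p) (X n))" .

lemma padic_seq_null_0: "padic_seq_null 0"
  by transfer (simp add: prime_card)

lemma padic_seq_null_add: "padic_seq_null X \<Longrightarrow> padic_seq_null Y \<Longrightarrow> padic_seq_null (X + Y)"
  by transfer (simp add: prime_card padic_null_add)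

lemma padic_seq_null_minus: "padic_seq_null X \<Longrightarrow> padic_seq_null (- X)"
  by transfer (simp add: prime_card)

lemma padic_seq_null_mult: "padic_seq_null X \<Longrightarrow> padic_seq_null (X * Y)"
  by transfer (metis padic_Cauchy_bounded[OF prime_card] padic_null_mult_bounded[OF prime_card])

lemma padic_seq_null_cong: "padic_seq_null (X - Y) \<Longrightarrow> padic_seq_null X \<longleftrightarrow> padic_seq_null Y"
  using padic_seq_null_add[of "X - Y" Y] padic_seq_null_add[of "Y - X" X]
    padic_seq_null_minus[of "X - Y"] by auto

lemma padic_seq_null_const: "padic_seq_null (padic_seq_const q) \<longleftrightarrow> q = 0"
  by transfer (simp add: prime_card padic_null_def LIMSEQ_const_iff)

lemma padic_seq_null_inverse:
  assumes "\<not> padic_seq_null X"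
  shows "padic_seq_null (padic_seq_inverse X * X - 1)"
  using assms
proof transfer
  fix X :: "nat \<Rightarrow> rat"
  assume X: "padic_Cauchy CARD('a) X" "\<not> padic_null CARD('a) X"
  obtain b M where "b > 0" "\<And>n. n \<ge> M \<Longrightarrow> padic_abs CARD('a) (X n) > b"
    using padic_not_null_away[OF prime_card X] by metis
  hence "X n \<noteq> 0" if "n \<ge> M" for n
    using that by force
  hence "\<forall>n\<ge>M. padic_abs CARD('a) (inverse (X n) * X n - 1) \<le> 0"
    by simp
  hence "eventually (\<lambda>n. padic_abs CARD('a) (inverse (X n) * X n - 1) \<le> 0) sequentially"
    unfolding eventually_sequentially by blast
  thus "padic_null CARD('a)
      (\<lambda>n. (if padic_null CARD('a) X then \<lambda>n. 0 else (\<lambda>n. inverse (X n))) n * X n - 1)"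
    using X padic_null_bound[OF prime_card tendsto_const] by simp
qed

lemma padic_seq_null_inverse_diff:
  assumes "padic_seq_null (X - Y)"
  shows "padic_seq_null (padic_seq_inverse X - padic_seq_inverse Y)"
proof (cases "padic_seq_null X")
  case True
  hence "padic_seq_null Y"
    using padic_seq_null_cong assms by blast
  with True have "padic_seq_inverse X = 0" "padic_seq_inverse Y = 0"
    by (transfer; simp)+
  thus ?thesis
    by (simp add: padic_seq_null_0)
next
  case False
  hence "\<not> padic_seq_null Y"
    using padic_seq_null_cong assms by blast
  with False assms show ?thesis
    by transfer (simp add: prime_card padic_null_inverse_diff)
qed

lemma padic_abs_tendsto_norm:
  "padic_Cauchy CARD('p::prime_card) X \<Longrightarrow>
    (\<lambda>n. padic_abs CARD('p) (X n)) \<longlonglongrightarrow> lim (\<lambda>n. padic_abs CARD('p) (X n))"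
  by (simp add: convergent_LIMSEQ_iff[symmetric] padic_abs_convergent prime_card)

lemma padic_seq_norm_mult: "padic_seq_norm (X * Y) = padic_seq_norm X * padic_seq_norm Y"
proof transfer
  fix X Y :: "nat \<Rightarrow> rat"
  assume "padic_Cauchy CARD('a) X" "padic_Cauchy CARD('a) Y"
  note * = tendsto_mult[OF this[THEN padic_abs_tendsto_norm]]
  show "lim (\<lambda>n. padic_abs CARD('a) (X n * Y n))
      = lim (\<lambda>n. padic_abs CARD('a) (X n)) * lim (\<lambda>n. padic_abs CARD('a) (Y n))"
    by (rule limI) (use * in \<open>simp add: padic_abs_mult prime_card\<close>)
qed

lemma padic_seq_norm_add:
  "padic_seq_norm (X + Y) \<le> max (padic_seq_norm X) (padic_seq_norm Y)"
proof transfer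
  fix X Y :: "nat \<Rightarrow> rat"
  assume XY: "padic_Cauchy CARD('a) X" "padic_Cauchy CARD('a) Y"
  show "lim (\<lambda>n. padic_abs CARD('a) (X n + Y n))
      \<le> max (lim (\<lambda>n. padic_abs CARD('a) (X n))) (lim (\<lambda>n. padic_abs CARD('a) (Y n)))"
    by (rule tendsto_le[OF sequentially_bot tendsto_max
          padic_abs_tendsto_norm[OF padic_Cauchy_add]])
       (use XY in \<open>auto intro!: padic_abs_tendsto_norm padic_abs_add always_eventually
          simp: prime_card\<close>)
qed

lemma padic_seq_norm_nonneg: "padic_seq_norm X \<ge> 0"
  by transfer (rule LIMSEQ_le_const[OF padic_abs_tendsto_norm]; simp add: prime_card)

lemma padic_seq_norm_eq_0_iff: "padic_seq_norm X = 0 \<longleftrightarrow> padic_seq_null X"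
  by transfer (metis LIMSEQ_unique padic_abs_tendsto_norm padic_null_def)

lemma padic_seq_norm_const: "padic_seq_norm (padic_seq_const q :: 'p padic_seq)
    = padic_abs CARD('p::prime_card) q"
  by transfer simp

lemma padic_seq_norm_minus: "padic_seq_norm (- X) = padic_seq_norm X"
  by transfer (simp add: prime_card)

lemma padic_seq_norm_cong:
  assumes "padic_seq_null (X - Y)"
  shows "padic_seq_norm X = padic_seq_norm Y"
proof -
  have *: "padic_seq_norm X \<le> padic_seq_norm Y" if "padic_seq_null (X - Y)"
    for X Y :: "'a padic_seq"
    using padic_seq_norm_add[of "X - Y" Y] padic_seq_norm_eq_0_iff[of "X - Y"] that
      padic_seq_norm_nonneg[of Y] by simp
  show ?thesis
    using *[OF assms] *[of Y X] padic_seq_null_minus[OF assms] by simp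
qed

lemma padic_seq_dense:
  assumes "e > 0"
  shows "\<exists>q. padic_seq_norm (X - padic_seq_const q) < e"
  using assms
proof transfer
  fix e :: real and X :: "nat \<Rightarrow> rat"
  assume e: "e > 0" and X: "padic_Cauchy CARD('a) X"
  have "e / 2 > 0"
    using e by simp
  then obtain M where M: "\<And>m n. m \<ge> M \<Longrightarrow> n \<ge> M \<Longrightarrow> padic_abs CARD('a) (X m - X n) < e / 2"
    using X unfolding padic_Cauchy_def by metis
  have "padic_Cauchy CARD('a) (\<lambda>n. X n - X M)"
    using padic_Cauchy_diff[OF prime_card X padic_Cauchy_const[OF prime_card]] .
  from padic_abs_tendsto_norm[OF this]
  have "lim (\<lambda>n. padic_abs CARD('a) (X n - X M)) \<le> e / 2"
    by (rule LIMSEQ_le_const2) (use M less_imp_le in blast)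
  thus "\<exists>q. lim (\<lambda>n. padic_abs CARD('a) (X n - q)) < e"
    using e by (intro exI[of _ "X M"]) simp
qed

quotient_type (overloaded) 'p padic = "'p::prime_card padic_seq"
  / "\<lambda>X Y. padic_seq_null (X - Y)"
proof (rule equivpI)
  show "reflp (\<lambda>X Y :: 'p padic_seq. padic_seq_null (X - Y))"
    by (auto intro: reflpI simp: padic_seq_null_0)
  show "symp (\<lambda>X Y :: 'p padic_seq. padic_seq_null (X - Y))"
    by (rule sympI) (use padic_seq_null_minus in fastforce)
  show "transp (\<lambda>X Y :: 'p padic_seq. padic_seq_null (X - Y))"
    by (rule transpI) (use padic_seq_null_add in fastforce)
qed

instantiation padic :: (prime_card) field
begin

lift_definition zero_padic :: "'a padic" is 0 .

lift_definition one_padic :: "'a padic" is 1 .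

lift_definition plus_padic :: "'a padic \<Rightarrow> 'a padic \<Rightarrow> 'a padic" is "(+)"
  using padic_seq_null_add by (fastforce simp: algebra_simps)

lift_definition uminus_padic :: "'a padic \<Rightarrow> 'a padic" is uminus
  using padic_seq_null_minus by fastforce

lift_definition minus_padic :: "'a padic \<Rightarrow> 'a padic \<Rightarrow> 'a padic" is "(-)"
proof -
  fix X X' Y Y' :: "'a padic_seq"
  assume "padic_seq_null (X - X')" "padic_seq_null (Y - Y')"
  hence "padic_seq_null ((X - X') + - (Y - Y'))"
    by (intro padic_seq_null_add padic_seq_null_minus)
  thus "padic_seq_null (X - Y - (X' - Y'))"
    by (simp add: algebra_simps)
qed

lift_definition times_padic :: "'a padic \<Rightarrow> 'a padic \<Rightarrow> 'a padic" is "(*)"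
proof -
  fix X X' Y Y' :: "'a padic_seq"
  assume "padic_seq_null (X - X')" "padic_seq_null (Y - Y')"
  hence "padic_seq_null ((X - X') * Y + (Y - Y') * X')"
    by (intro padic_seq_null_add padic_seq_null_mult)
  thus "padic_seq_null (X * Y - X' * Y')"
    by (simp add: algebra_simps)
qed

lift_definition inverse_padic :: "'a padic \<Rightarrow> 'a padic" is padic_seq_inverse
  by (rule padic_seq_null_inverse_diff)

definition divide_padic :: "'a padic \<Rightarrow> 'a padic \<Rightarrow> 'a padic" where
  "divide_padic x y = x * inverse y"

instance
proof
  fix a b c :: "'a padic"
  show "a * b * c = a * (b * c)" "a * b = b * a" "1 * a = a" "(a + b) * c = a * c + b * c"
    "a + b + c = a + (b + c)" "a + b = b + a" "0 + a = a" "- a + a = 0" "a - b = a + - b"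
    by (transfer; simp add: algebra_simps padic_seq_null_0)+
  show "(0 :: 'a padic) \<noteq> 1"
  proof transfer
    have "(1 :: 'a padic_seq) = padic_seq_const 1"
      by transfer simp
    thus "\<not> padic_seq_null (0 - 1 :: 'a padic_seq)"
      using padic_seq_null_minus[of "- 1 :: 'a padic_seq"]
        padic_seq_null_const[of 1, where 'a = 'a] by auto
  qed
  show "a \<noteq> 0 \<Longrightarrow> inverse a * a = 1"
    by transfer (simp add: padic_seq_null_inverse)
  show "inverse (0 :: 'a padic) = 0"
  proof transfer
    have "padic_seq_inverse 0 = (0 :: 'a padic_seq)"
      by transfer (simp add: prime_card)
    thus "padic_seq_null (padic_seq_inverse 0 - 0 :: 'a padic_seq)"
      by (simp add: padic_seq_null_0)
  qed
qed (simp add: divide_padic_def)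

end

lemma padic_const_of_nat:
  "abs_padic (padic_seq_const (of_nat n)) = (of_nat n :: 'p::prime_card padic)"
proof (induction n)
  case 0
  have "padic_seq_const 0 = (0 :: 'p padic_seq)"
    by transfer simp
  thus ?case
    by (simp only: zero_padic_def of_nat_0)
next
  case (Suc n)
  have "padic_seq_const (of_nat (Suc n)) = (1 :: 'p padic_seq) + padic_seq_const (of_nat n)"
    by transfer simp
  hence "abs_padic (padic_seq_const (of_nat (Suc n)) :: 'p padic_seq)
       = abs_padic 1 + abs_padic (padic_seq_const (of_nat n))"
    by (simp only: plus_padic.abs_eq)
  thus ?case
    using Suc by (simp add: one_padic_def)
qed

instance padic :: (prime_card) field_char_0
proof
  show "inj (of_nat :: nat \<Rightarrow> 'a padic)"
  proof (rule injI)
    fix m n :: nat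
    assume "(of_nat m :: 'a padic) = of_nat n"
    hence "padic_seq_null (padic_seq_const (of_nat m) - padic_seq_const (of_nat n) :: 'a padic_seq)"
      by (simp add: padic.abs_eq_iff flip: padic_const_of_nat)
    also have "padic_seq_const (of_nat m) - padic_seq_const (of_nat n)
        = (padic_seq_const (of_nat m - of_nat n) :: 'a padic_seq)"
      by transfer simp
    finally show "m = n"
      by (simp add: padic_seq_null_const)
  qed
qed

lift_definition padic_norm :: "'p::prime_card padic \<Rightarrow> real" is padic_seq_norm
  by (rule padic_seq_norm_cong)

instantiation padic :: (prime_card) metric_space
begin

definition dist_padic :: "'a padic \<Rightarrow> 'a padic \<Rightarrow> real" where
  "dist_padic x y = padic_norm (x - y)"

definition uniformity_padic :: "('a padic \<times> 'a padic) filter" where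
  "uniformity_padic = (INF e\<in>{0 <..}. principal {(x, y). dist x y < e})"

definition open_padic :: "'a padic set \<Rightarrow> bool" where
  "open_padic U \<longleftrightarrow> (\<forall>x\<in>U. eventually (\<lambda>(x', y). x' = x \<longrightarrow> y \<in> U) uniformity)"

instance
proof
  fix x y z :: "'a padic" and U :: "'a padic set"
  show "dist x y = 0 \<longleftrightarrow> x = y"
    unfolding dist_padic_def by transfer (rule padic_seq_norm_eq_0_iff)
  show "dist x y \<le> dist x z + dist y z"
    unfolding dist_padic_def
  proof transfer
    fix x y z :: "'a padic_seq"
    show "padic_seq_norm (x - y) \<le> padic_seq_norm (x - z) + padic_seq_norm (y - z)"
      using padic_seq_norm_add[of "x - z" "- (y - z)"] padic_seq_norm_minus[of "y - z"]
        padic_seq_norm_nonneg[of "x - z"] padic_seq_norm_nonneg[of "y - z"] by simp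
  qed
qed (auto simp: uniformity_padic_def open_padic_def)

end

lemma padic_norm_mult: "padic_norm (x * y) = padic_norm x * padic_norm y" for x y :: "'p::prime_card padic"
  by transfer (rule padic_seq_norm_mult)

lemma padic_norm_add: "padic_norm (x + y) \<le> max (padic_norm x) (padic_norm y)" for x y :: "'p::prime_card padic"
  by transfer (rule padic_seq_norm_add)

lemma padic_norm_minus [simp]: "padic_norm (- x) = padic_norm x" for x :: "'p::prime_card padic"
  by transfer (rule padic_seq_norm_minus)

lemma padic_norm_nonneg [simp]: "padic_norm x \<ge> 0" for x :: "'p::prime_card padic"
  by transfer (rule padic_seq_norm_nonneg)

lemma padic_norm_eq_0_iff [simp]: "padic_norm x = 0 \<longleftrightarrow> x = 0" for x :: "'p::prime_card padic"
  using dist_eq_0_iff[of x 0] by (simp add: dist_padic_def del: dist_eq_0_iff)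

lemma padic_of_rat: "abs_padic (padic_seq_const q) = (of_rat q :: 'p::prime_card padic)"
proof -
  obtain a b where ab: "q = of_int a / of_int b" "b > 0"
    by (metis quotient_of_denom_pos' quotient_of_div surj_pair snd_conv)
  define c :: "rat \<Rightarrow> 'p padic" where "c = (\<lambda>q. abs_padic (padic_seq_const q))"
  have nat: "c (of_nat n) = of_nat n" for n
    by (simp add: c_def padic_const_of_nat)
  have minus: "c (- r) = - c r" and mult: "c (r * s) = c r * c s" for r s
  proof -
    have 1: "padic_seq_const (- r) = (- padic_seq_const r :: 'p padic_seq)"
      and 2: "padic_seq_const (r * s) = (padic_seq_const r * padic_seq_const s :: 'p padic_seq)"
      by (transfer; simp)+
    show "c (- r) = - c r" "c (r * s) = c r * c s"
      by (simp_all add: c_def 1 2 uminus_padic.abs_eq times_padic.abs_eq)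
  qed
  have int: "c (of_int k) = of_int k" for k
    using nat[of "nat k"] nat[of "nat (- k)"] minus[of "of_nat (nat (- k))"]
    by (cases "k \<ge> 0") auto
  have "c q * of_int b = of_int a"
    using ab mult[of q "of_int b"] by (simp add: int)
  hence "c q = of_int a / of_int b"
    using ab(2) by (simp add: nonzero_eq_divide_eq)
  also have "\<dots> = of_rat q"
    by (simp add: ab(1) of_rat_divide)
  finally show ?thesis
    by (simp add: c_def)
qed

lemma padic_norm_of_rat: "padic_norm (of_rat q :: 'p::prime_card padic) = padic_abs CARD('p) q"
  unfolding padic_of_rat[symmetric] padic_norm.abs_eq by (rule padic_seq_norm_const)

lemma padic_rat_dense:
  fixes x :: "'p::prime_card padic"
  assumes "e > 0"
  shows "\<exists>q. padic_norm (x - of_rat q) < e"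
proof -
  obtain X where X: "x = abs_padic X"
    by (metis Quotient_abs_rep Quotient_padic)
  obtain q where "padic_seq_norm (X - padic_seq_const q) < e"
    using padic_seq_dense[OF assms] by blast
  hence "padic_norm (x - of_rat q) < e"
    by (simp add: X minus_padic.abs_eq padic_norm.abs_eq flip: padic_of_rat)
  thus ?thesis ..
qed

text \<open>
  The values \<open>x j\<close> for \<open>j < k\<close> are irrelevant, and \<open>k\<close> need not be the position of the first
  nonzero digit; leading zeros do not change the sum of the terms with \<open>j \<le> 0\<close>.
\<close>

definition browkin_expansion :: "'p::prime_card padic \<Rightarrow> int \<Rightarrow> (int \<Rightarrow> int) \<Rightarrow> bool" where
  "browkin_expansion \<alpha> k x \<longleftrightarrow>
     (\<forall>j\<ge>k. 2 * \<bar>x j\<bar> < int CARD('p)) \<and>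
     (\<lambda>n. of_int (x (k + int n)) * of_nat CARD('p) powi (k + int n)) sums \<alpha>"

definition browkin_s :: "'p::prime_card padic \<Rightarrow> rat" where
  "browkin_s \<alpha> = (THE s. \<exists>k x. browkin_expansion \<alpha> k x \<and>
     s = (\<Sum>j\<in>{k..0}. of_int (x j) * of_nat CARD('p) powi j))"

lemma padic_abs_of_int_le: "prime p \<Longrightarrow> padic_abs p (of_int x) \<le> 1"
  using padic_abs_divide_int[of p x 1] prime_gt_1_nat[of p]
  by (cases "x = 0") (auto simp: power_int_minus inverse_le_1_iff)

lemma padic_abs_of_int_less_1:
  assumes "prime p" "padic_abs p (of_int x) < 1"
  shows "int p dvd x"
proof (cases "x = 0")
  case False
  hence "multiplicity (int p) x \<noteq> 0"
    using assms padic_abs_divide_int[of p x 1] by (cases "multiplicity (int p) x = 0") auto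
  thus ?thesis
    by (metis not_dvd_imp_multiplicity_0)
qed auto

lemma padic_abs_self: "prime p \<Longrightarrow> padic_abs p (of_nat p) = 1 / real p"
  using padic_abs_divide_int[of p "int p" 1] by (simp add: multiplicity_self power_int_minus field_simps)

lemma padic_abs_power: "prime p \<Longrightarrow> padic_abs p (q ^ n) = padic_abs p q ^ n"
  by (induction n) (auto simp: padic_abs_mult)

lemma padic_abs_power_int: "prime p \<Longrightarrow> padic_abs p (q powi j) = padic_abs p q powi j"
  by (cases j rule: int_cases2)
     (auto simp: power_int_minus padic_abs_inverse padic_abs_power)

lemma of_rat_power_int: "(of_rat (q powi j) :: 'a::field_char_0) = of_rat q powi j"
  by (cases j rule: int_cases2)
     (auto simp: power_int_minus of_rat_inverse of_rat_power)

lemma browkin_term_of_rat: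
  "(of_int x * of_nat CARD('p) powi j :: 'p::prime_card padic)
    = of_rat (of_int x * of_nat CARD('p) powi j)"
  by (simp add: of_rat_mult of_rat_power_int)

lemma browkin_term_norm:
  "padic_norm (of_int x * of_nat CARD('p) powi j :: 'p::prime_card padic)
    \<le> (1 / real CARD('p)) powi j"
  unfolding browkin_term_of_rat padic_norm_of_rat
  using padic_abs_of_int_le[OF prime_card[where 'a = 'p], of x]
  by (simp add: padic_abs_mult prime_card padic_abs_power_int padic_abs_self
      mult_left_le_one_le)

lemma padic_norm_0 [simp]: "padic_norm 0 = 0"
  by (simp only: padic_norm_eq_0_iff)

lemma padic_norm_sum_le:
  assumes "\<And>i. i \<in> A \<Longrightarrow> padic_norm (f i :: 'p::prime_card padic) \<le> c" "c \<ge> 0"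
  shows "padic_norm (sum f A) \<le> c"
proof (cases "finite A")
  case True
  thus ?thesis
    using assms(1)
  proof induction
    case empty
    show ?case
      using assms(2) by simp
  next
    case (insert i A)
    hence "padic_norm (f i) \<le> c" "padic_norm (sum f A) \<le> c"
      by auto
    thus ?case
      using padic_norm_add[of "f i" "sum f A"] insert.hyps by simp
  qed
qed (use assms(2) in simp)

lemma padic_sums_tail:
  fixes f :: "nat \<Rightarrow> 'p::prime_card padic"
  assumes f: "f sums \<alpha>" and c: "\<And>n. n \<ge> N \<Longrightarrow> padic_norm (f n) \<le> c" "c \<ge> 0"
  shows "padic_norm (\<alpha> - (\<Sum>i<N. f i)) \<le> c"
proof (rule ccontr)
  assume contr: "\<not> ?thesis"
  define e where "e = padic_norm (\<alpha> - (\<Sum>i<N. f i))"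
  have "e > 0"
    using contr c(2) by (simp add: e_def)
  hence "eventually (\<lambda>n. dist (\<Sum>i<n. f i) \<alpha> < e) sequentially"
    using f unfolding sums_def by (rule tendstoD[rotated])
  hence "eventually (\<lambda>n. dist (\<Sum>i<n. f i) \<alpha> < e \<and> n \<ge> N) sequentially"
    using eventually_ge_at_top by (rule eventually_conj)
  then obtain n where n: "dist (\<Sum>i<n. f i) \<alpha> < e" "n \<ge> N"
    unfolding eventually_sequentially by blast
  have "(\<Sum>i<n. f i) = (\<Sum>i<N. f i) + (\<Sum>i\<in>{N..<n}. f i)"
    using sum.atLeastLessThan_concat[of 0 N n f] n(2) by (simp add: atLeast0LessThan)
  hence "padic_norm ((\<Sum>i<n. f i) - (\<Sum>i<N. f i)) \<le> c"
    using c by (auto intro: padic_norm_sum_le)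
  moreover have "padic_norm (\<alpha> - (\<Sum>i<n. f i)) < e"
    using n(1) padic_norm_minus[of "\<alpha> - (\<Sum>i<n. f i)"] by (simp add: dist_padic_def)
  moreover have "e \<le> max (padic_norm (\<alpha> - (\<Sum>i<n. f i))) (padic_norm ((\<Sum>i<n. f i) - (\<Sum>i<N. f i)))"
    using padic_norm_add[of "\<alpha> - (\<Sum>i<n. f i)" "(\<Sum>i<n. f i) - (\<Sum>i<N. f i)"]
    by (simp add: e_def)
  ultimately show False
    using contr by (auto simp: e_def le_max_iff_disj)
qed

lemma browkin_expansion_norm_diff:
  fixes \<alpha> :: "'p::prime_card padic"
  assumes "browkin_expansion \<alpha> k x"
  shows "padic_norm (\<alpha> - of_rat (\<Sum>j\<in>{k..0}. of_int (x j) * of_nat CARD('p) powi j))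
    \<le> 1 / real CARD('p)"
proof -
  define N where "N = nat (1 - k)"
  define f where "f = (\<lambda>n. of_int (x (k + int n)) * of_nat CARD('p) powi (k + int n) :: 'p padic)"
  have p1: "real CARD('p) > 1"
    using prime_gt_1_nat[OF prime_card[where 'a = 'p]] by simp
  have "padic_norm (f n) \<le> 1 / real CARD('p)" if "n \<ge> N" for n
  proof -
    have "padic_norm (f n) \<le> (1 / real CARD('p)) powi (k + int n)"
      unfolding f_def by (rule browkin_term_norm)
    also have "\<dots> \<le> (1 / real CARD('p)) powi 1"
      using that p1 by (intro power_int_decreasing) (auto simp: N_def)
    finally show ?thesis
      by simp
  qed
  hence "padic_norm (\<alpha> - (\<Sum>i<N. f i)) \<le> 1 / real CARD('p)"
    using assms by (intro padic_sums_tail) (auto simp: browkin_expansion_def f_def)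
  also have "(\<Sum>i<N. f i) = (\<Sum>j\<in>{k..0}. of_int (x j) * of_nat CARD('p) powi j)"
    by (rule sum.reindex_bij_witness[of _ "\<lambda>j. nat (j - k)" "\<lambda>n. k + int n"])
       (auto simp: N_def f_def)
  also have "\<dots> = of_rat (\<Sum>j\<in>{k..0}. of_int (x j) * of_nat CARD('p) powi j)"
    by (simp only: browkin_term_of_rat of_rat_sum)
  finally show ?thesis .
qed

lemma browkin_sum_bound:
  assumes "prime p" "\<And>j. j \<ge> k \<Longrightarrow> 2 * \<bar>x j\<bar> < int p"
  shows "2 * \<bar>\<Sum>j\<in>{k..0}. of_int (x j) * of_nat p powi j :: rat\<bar> < of_nat p"
proof -
  have p1: "(of_nat p :: rat) > 1"
    using prime_gt_1_nat[OF assms(1)] by simp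
  have "2 * \<bar>\<Sum>j\<in>{1 - int n..0}. of_int (x j) * of_nat p powi j :: rat\<bar>
      \<le> of_nat p - of_nat p powi (1 - int n)" if "1 - int n \<ge> k" for n
    using that
  proof (induction n)
    case (Suc n)
    define y :: rat where "y = of_int (x (- int n)) * of_nat p powi (- int n)"
    have "{- int n..0} = insert (- int n) {1 - int n..0}"
      by auto
    hence "(\<Sum>j\<in>{- int n..0}. of_int (x j) * of_nat p powi j :: rat)
        = y + (\<Sum>j\<in>{1 - int n..0}. of_int (x j) * of_nat p powi j)"
      by (simp add: y_def)
    moreover have "2 * \<bar>\<Sum>j\<in>{1 - int n..0}. of_int (x j) * of_nat p powi j :: rat\<bar>
      \<le> of_nat p - of_nat p powi (1 - int n)"
      using Suc by simp
    moreover have "2 * \<bar>y\<bar> \<le> of_nat p powi (1 - int n) - of_nat p powi (- int n)"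
    proof -
      have "2 * \<bar>x (- int n)\<bar> \<le> int p - 1"
        using assms(2)[of "- int n"] Suc.prems by simp
      hence "of_int (2 * \<bar>x (- int n)\<bar>) \<le> (of_int (int p - 1) :: rat)"
        by (simp only: of_int_le_iff)
      hence "2 * \<bar>of_int (x (- int n))\<bar> \<le> (of_nat p - 1 :: rat)"
        by simp
      hence "2 * \<bar>of_int (x (- int n))\<bar> * of_nat p powi (- int n)
          \<le> (of_nat p - 1 :: rat) * of_nat p powi (- int n)"
        using p1 by (intro mult_right_mono) auto
      moreover have "(of_nat p :: rat) powi (1 - int n) = of_nat p * of_nat p powi (- int n)"
        using p1 power_int_add[of "of_nat p :: rat" 1 "- int n"] by simp
      ultimately show ?thesis
        using p1 by (simp add: y_def abs_mult algebra_simps)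
    qed
    ultimately show ?case
      using abs_triangle_ineq[of y "\<Sum>j\<in>{1 - int n..0}. of_int (x j) * of_nat p powi j"]
      by simp
  qed auto
  note bound = this[of "nat (1 - k)"]
  show ?thesis
  proof (cases "k \<le> 1")
    case True
    have "(of_nat p :: rat) powi k > 0"
      using p1 by simp
    with True bound show ?thesis
      by simp
  qed (use p1 in auto)
qed

lemma browkin_sum_unique:
  fixes \<alpha> :: "'p::prime_card padic"
  assumes "browkin_expansion \<alpha> k x" "browkin_expansion \<alpha> l y"
  shows "(\<Sum>j\<in>{k..0}. of_int (x j) * of_nat CARD('p) powi j :: rat)
       = (\<Sum>j\<in>{l..0}. of_int (y j) * of_nat CARD('p) powi j)" (is "?s = ?t")
proof -
  define p where "p = CARD('p)"
  have p: "prime p"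
    by (simp add: p_def prime_card)
  have p1: "p > 1"
    by (rule prime_gt_1_nat[OF p])
  have "padic_norm ((\<alpha> - of_rat ?t) + - (\<alpha> - of_rat ?s)) \<le> 1 / real p"
    using padic_norm_add[of "\<alpha> - of_rat ?t" "- (\<alpha> - of_rat ?s)"]
      browkin_expansion_norm_diff[OF assms(1)] browkin_expansion_norm_diff[OF assms(2)]
    by (simp only: p_def padic_norm_minus)
  also have "(\<alpha> - of_rat ?t) + - (\<alpha> - of_rat ?s) = of_rat (?s - ?t)"
    by (simp add: of_rat_diff)
  finally have "padic_abs p (?s - ?t) \<le> 1 / real p"
    by (simp add: padic_norm_of_rat p_def)
  also have "\<dots> < 1"
    using p1 by simp
  finally have less1: "padic_abs p (?s - ?t) < 1" .
  have clear: "\<exists>a n. (\<Sum>j\<in>{k..0}. of_int (x j) * of_nat p powi j :: rat) = of_int a / of_nat p ^ n"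
    for k x
  proof -
    define n where "n = nat (- k)"
    have "(\<Sum>j\<in>{k..0}. of_int (x j) * of_nat p powi j :: rat) * of_nat p ^ n
        = of_int (\<Sum>j\<in>{k..0}. x j * int p ^ nat (j + int n))"
      unfolding sum_distrib_right of_int_sum
    proof (rule sum.cong)
      fix j assume j: "j \<in> {k..0}"
      have "of_nat p powi j * of_nat p ^ n = (of_nat p powi (j + int n) :: rat)"
        using p1 by (simp add: power_int_add)
      also have "\<dots> = of_nat p ^ nat (j + int n)"
        using j by (simp add: power_int_def n_def)
      finally show "of_int (x j) * of_nat p powi j * of_nat p ^ n
          = (of_int (x j * int p ^ nat (j + int n)) :: rat)"
        by (simp add: mult.assoc)
    qed simp
    thus ?thesis
      using p1 by (intro exI[of _ "\<Sum>j\<in>{k..0}. x j * int p ^ nat (j + int n)"] exI[of _ n])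
        (simp add: nonzero_eq_divide_eq)
  qed
  obtain a m b n where ab: "?s = of_int a / of_nat p ^ m" "?t = of_int b / of_nat p ^ n"
    using clear[of x k] clear[of y l] unfolding p_def by auto
  define c where "c = a * int p ^ n - b * int p ^ m"
  have c: "?s - ?t = of_int c / of_nat p ^ (m + n)"
    using p1 unfolding ab c_def by (simp add: field_simps power_add)
  have "?s - ?t = 0"
  proof (rule ccontr)
    assume nz: "?s - ?t \<noteq> 0"
    hence c0: "c \<noteq> 0"
      using c by auto
    have pe: "of_nat p ^ i = (of_int (int p ^ i) :: rat)" for i
      by simp
    have "padic_abs p (?s - ?t)
        = real p powi (int (multiplicity (int p) (int p ^ (m + n))) - int (multiplicity (int p) c))"
      unfolding c pe using p c0 p1 by (intro padic_abs_divide_int) auto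
    also have "multiplicity (int p) (int p ^ (m + n)) = m + n"
      using p1 by (intro multiplicity_same_power) auto
    finally have pw: "real p powi (int (m + n) - int (multiplicity (int p) c)) < 1"
      using less1 by simp
    have "multiplicity (int p) c > m + n"
    proof (rule ccontr)
      assume "\<not> ?thesis"
      hence "real p powi (int (m + n) - int (multiplicity (int p) c)) \<ge> 1"
        using p1 by (intro one_le_power_int) auto
      with pw show False
        by simp
    qed
    hence "int p ^ (m + n + 1) dvd c"
      by (intro multiplicity_dvd') auto
    then obtain d where "c = int p ^ (m + n + 1) * d"
      by blast
    hence st: "?s - ?t = of_int (int p * d)"
      using c p1 by simp
    have "\<bar>?s - ?t\<bar> < of_nat p"
      using browkin_sum_bound[OF p, of k x] browkin_sum_bound[OF p, of l y] assms
      by (auto simp: browkin_expansion_def p_def)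
    hence "(of_int \<bar>int p * d\<bar> :: rat) < of_int (int p)"
      unfolding st by simp
    hence "\<bar>int p * d\<bar> < int p"
      by (simp only: of_int_less_iff)
    hence "d = 0"
      using p1 by (auto simp: abs_mult)
    thus False
      using nz st by simp
  qed
  thus ?thesis
    by simp
qed

lemma browkin_s_eq:
  fixes \<alpha> :: "'p::prime_card padic"
  assumes "browkin_expansion \<alpha> k x"
  shows "browkin_s \<alpha> = (\<Sum>j\<in>{k..0}. of_int (x j) * of_nat CARD('p) powi j)"
  unfolding browkin_s_def using assms browkin_sum_unique by (intro the_equality) blast+

lemma balanced_digit_exists:
  fixes \<beta> :: "'p::prime_card padic"
  assumes "odd CARD('p)" "padic_norm \<beta> \<le> 1"
  shows "\<exists>x. 2 * \<bar>x\<bar> < int CARD('p) \<and> padic_norm (\<beta> - of_int x) \<le> 1 / real CARD('p)"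
proof -
  define p where "p = CARD('p)"
  have p: "prime p"
    by (simp add: p_def prime_card)
  have p1: "p > 1"
    by (rule prime_gt_1_nat[OF p])
  have ex: "\<exists>x. 2 * \<bar>x\<bar> < int p \<and> int p dvd (u - x)" for u
  proof (cases "2 * (u mod int p) < int p")
    case True
    thus ?thesis
      using p1 by (intro exI[of _ "u mod int p"]) auto
  next
    case False
    have "u - (u mod int p - int p) = (u - u mod int p) + int p"
      by simp
    hence "int p dvd (u - (u mod int p - int p))"
      by (metis dvd_add dvd_minus_mod dvd_refl)
    moreover have "2 * (u mod int p) \<noteq> int p"
      using assms(1) by (metis dvd_triv_left even_of_nat p_def)
    moreover have "u mod int p < int p"
      using p1 by simp
    ultimately show ?thesis
      using False by (intro exI[of _ "u mod int p - int p"]) auto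
  qed
  obtain q where q: "padic_norm (\<beta> - of_rat q) < 1 / real p"
    using padic_rat_dense[of "1 / real p" \<beta>] p1 by auto
  have "padic_norm (of_rat q :: 'p padic) \<le> 1"
  proof -
    have "padic_norm (of_rat q :: 'p padic) \<le> max (padic_norm \<beta>) (padic_norm (- (\<beta> - of_rat q)))"
      using padic_norm_add[of \<beta> "- (\<beta> - of_rat q)"] by simp
    also have "\<dots> \<le> 1"
      unfolding padic_norm_minus using assms(2) q p1
      by (auto intro: order.trans[OF less_imp_le[OF q]])
    finally show ?thesis .
  qed
  hence q1: "padic_abs p q \<le> 1"
    by (simp add: padic_norm_of_rat p_def)
  obtain a b where ab: "quotient_of q = (a, b)"
    by fastforce
  have b: "b > 0" "coprime a b" and qab: "q = of_int a / of_int b"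
    using quotient_of_denom_pos[OF ab] quotient_of_coprime[OF ab] quotient_of_div[OF ab] by auto
  have pb: "\<not> int p dvd b"
  proof
    assume dvd: "int p dvd b"
    hence na: "\<not> int p dvd a"
      using b(2) p1 coprime_common_divisor[of a b "int p"] by auto
    hence "a \<noteq> 0"
      by auto
    have "multiplicity (int p) b \<noteq> 0"
      using dvd b p1 by (simp add: multiplicity_eq_zero_iff)
    moreover have "multiplicity (int p) a = 0"
      using na by (rule not_dvd_imp_multiplicity_0)
    ultimately have "padic_abs p q > 1"
      using \<open>a \<noteq> 0\<close> b p p1 unfolding qab
      by (subst padic_abs_divide_int) auto
    with q1 show False
      by simp
  qed
  hence "coprime (int p) b"
    using p by (simp add: prime_imp_coprime)
  then obtain c where "[b * c = 1] (mod int p)"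
    using cong_solve_coprime_int coprime_commute by blast
  hence c: "int p dvd b * c - 1"
    by (simp add: cong_iff_dvd_diff)
  obtain x where x: "2 * \<bar>x\<bar> < int p" "int p dvd (a * c - x)"
    using ex by blast
  have "a - b * x = b * (a * c - x) - a * (b * c - 1)"
    by (simp add: algebra_simps)
  hence "int p dvd a - b * x"
    using c x by (metis dvd_diff dvd_mult)
  then obtain d where d: "a - b * x = int p * d"
    by blast
  have "q - of_int x = of_int (a - b * x) / of_int b"
    using b(1) by (simp add: qab field_simps)
  also have "\<dots> = of_nat p * of_int d * inverse (of_int b)"
    unfolding d by (simp add: field_simps)
  finally have qx: "q - of_int x = of_nat p * of_int d * inverse (of_int b)" .
  have "padic_abs p (of_int b) = 1"
    using padic_abs_divide_int[OF p, of b 1] b(1) not_dvd_imp_multiplicity_0[OF pb] by simp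
  hence "padic_abs p (q - of_int x) \<le> 1 / real p"
    unfolding qx padic_abs_mult[OF p] padic_abs_inverse[OF p] padic_abs_self[OF p]
    using p1 padic_abs_of_int_le[OF p, of d] by (simp add: divide_right_mono)
  hence "padic_norm (of_rat (q - of_int x) :: 'p padic) \<le> 1 / real p"
    by (simp add: padic_norm_of_rat p_def)
  hence "padic_norm ((\<beta> - of_rat q) + of_rat (q - of_int x)) \<le> 1 / real p"
    using padic_norm_add[of "\<beta> - of_rat q" "of_rat (q - of_int x)"] q by simp
  also have "(\<beta> - of_rat q) + of_rat (q - of_int x) = \<beta> - of_int x"
    by (simp add: of_rat_diff)
  finally have "padic_norm (\<beta> - of_int x) \<le> 1 / real p" .
  with x show ?thesis
    unfolding p_def by blast
qed

lemma padic_norm_power: "padic_norm (x ^ n) = padic_norm x ^ n"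
proof (induction n)
  case 0
  have "padic_norm (of_rat 1 :: 'a padic) = 1"
    unfolding padic_norm_of_rat by (simp add: prime_card)
  thus ?case
    by simp
qed (auto simp: padic_norm_mult)

lemma browkin_expansion_exists:
  fixes \<alpha> :: "'p::prime_card padic"
  assumes odd: "odd CARD('p)"
  shows "\<exists>k x. browkin_expansion \<alpha> k x"
proof -
  define P :: "'p padic" where "P = of_nat CARD('p)"
  define r where "r = real CARD('p)"
  have r: "r > 1"
    using prime_gt_1_nat[OF prime_card[where 'a = 'p]] by (simp add: r_def)
  have P0: "P \<noteq> 0"
    unfolding P_def by simp
  have "P = of_rat (of_nat CARD('p))"
    by (simp only: P_def of_rat_of_nat_eq)
  hence P: "padic_norm P = 1 / r"
    by (simp only: padic_norm_of_rat padic_abs_self[OF prime_card] r_def)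
  define dig where "dig \<beta> = (SOME x. 2 * \<bar>x\<bar> < int CARD('p) \<and>
    padic_norm (\<beta> - of_int x) \<le> 1 / r)" for \<beta> :: "'p padic"
  have dig: "2 * \<bar>dig \<beta>\<bar> < int CARD('p)" "padic_norm (\<beta> - of_int (dig \<beta>)) \<le> 1 / r"
    if "padic_norm \<beta> \<le> 1" for \<beta> :: "'p padic"
    using someI_ex[OF balanced_digit_exists[OF odd that]] by (auto simp: dig_def r_def)
  obtain K where K: "padic_norm \<alpha> \<le> r ^ K"
    using real_arch_pow[OF r, of "padic_norm \<alpha>"] less_imp_le by blast
  define res where "res = rec_nat (\<alpha> * P ^ K) (\<lambda>_ \<beta>. (\<beta> - of_int (dig \<beta>)) / P)"
  have res_simps: "res 0 = \<alpha> * P ^ K" "res (Suc n) = (res n - of_int (dig (res n))) / P" for n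
    by (simp_all add: res_def)
  have res: "padic_norm (res n) \<le> 1" for n
  proof (induction n)
    case 0
    show ?case
      using K r by (simp add: res_simps padic_norm_mult padic_norm_power P field_simps)
  next
    case (Suc n)
    have "padic_norm (res (Suc n)) * padic_norm P = padic_norm (res n - of_int (dig (res n)))"
      using P0 by (simp add: res_simps flip: padic_norm_mult)
    also have "\<dots> \<le> 1 / r"
      by (rule dig(2)[OF Suc])
    finally show ?case
      using r by (simp add: P field_simps)
  qed
  define x where "x j = dig (res (nat (j + int K)))" for j
  define f where "f n = of_int (x (- int K + int n)) * P powi (- int K + int n)" for n
  have f: "f n = of_int (dig (res n)) * P ^ n / P ^ K" for n
  proof -
    have "P powi (- int K + int n) = P ^ n / P ^ K"
      using P0 by (subst power_int_add) (auto simp: power_int_minus field_simps)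
    thus ?thesis
      by (simp add: f_def x_def)
  qed
  have partial: "\<alpha> - (\<Sum>i<n. f i) = res n * P ^ n / P ^ K" for n
  proof (induction n)
    case (Suc n)
    have "\<alpha> - (\<Sum>i<Suc n. f i) = res n * P ^ n / P ^ K - f n"
      using Suc by (simp add: algebra_simps)
    also have "\<dots> = res (Suc n) * P ^ Suc n / P ^ K"
      using P0 by (simp add: f res_simps diff_divide_distrib left_diff_distrib)
    finally show ?case .
  qed (use P0 in \<open>simp add: res_simps\<close>)
  have "f sums \<alpha>"
    unfolding sums_def
  proof (rule metric_LIMSEQ_I)
    fix e :: real assume e: "e > 0"
    have "(\<lambda>n. r ^ K * (1 / r) ^ n) \<longlonglongrightarrow> r ^ K * 0"
      using r by (intro tendsto_mult_left LIMSEQ_power_zero) auto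
    hence "eventually (\<lambda>n. r ^ K * (1 / r) ^ n < e) sequentially"
      using e by (intro order_tendstoD(2)) auto
    then obtain N where N: "\<And>n. n \<ge> N \<Longrightarrow> r ^ K * (1 / r) ^ n < e"
      unfolding eventually_sequentially by blast
    have "dist (\<Sum>i<n. f i) \<alpha> \<le> r ^ K * (1 / r) ^ n" for n
    proof -
      have "dist (\<Sum>i<n. f i) \<alpha> = padic_norm (\<alpha> - (\<Sum>i<n. f i))"
        unfolding dist_padic_def using padic_norm_minus[of "\<alpha> - (\<Sum>i<n. f i)"] by simp
      also have "\<dots> * padic_norm (P ^ K) = padic_norm (res n) * (1 / r) ^ n"
        unfolding padic_norm_mult[symmetric] partial using P0
        by (simp add: padic_norm_mult padic_norm_power P)
      finally have "dist (\<Sum>i<n. f i) \<alpha> = r ^ K * (padic_norm (res n) * (1 / r) ^ n)"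
        using r by (simp add: padic_norm_power P field_simps)
      also have "\<dots> \<le> r ^ K * (1 * (1 / r) ^ n)"
        using r res by (intro mult_left_mono mult_right_mono) auto
      finally show ?thesis
        by simp
    qed
    thus "\<exists>N. \<forall>n\<ge>N. dist (\<Sum>i<n. f i) \<alpha> < e"
      using N le_less_trans by blast
  qed
  hence "browkin_expansion \<alpha> (- int K) x"
    unfolding browkin_expansion_def using dig(1) res by (simp add: f_def[abs_def] P_def x_def)
  thus ?thesis
    by blast
qed

text \<open>
  A point of \<open>\<rat>\<^sub>p\<^sup>m\<close> is a function on indices of which only the values at \<open>1, \<dots>, m\<close> matter: for
  \<open>1 \<le> i \<le> m\<close>, the value of \<open>jp_step m \<alpha>\<close> at \<open>i\<close> depends on \<open>\<alpha> 1, \<dots>, \<alpha> m\<close> only.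
\<close>

definition jp_step :: "nat \<Rightarrow> (nat \<Rightarrow> 'p::prime_card padic) \<Rightarrow> nat \<Rightarrow> 'p padic" where
  "jp_step m \<alpha> i =
     (if i = 1 then 1 / (\<alpha> m - of_rat (browkin_s (\<alpha> m)))
      else (\<alpha> (i - 1) - of_rat (browkin_s (\<alpha> (i - 1)))) / (\<alpha> m - of_rat (browkin_s (\<alpha> m))))"

definition jp_complete_quotient ::
    "nat \<Rightarrow> (nat \<Rightarrow> 'p::prime_card padic) \<Rightarrow> nat \<Rightarrow> nat \<Rightarrow> 'p padic" where
  "jp_complete_quotient m \<alpha> n = (jp_step m ^^ n) \<alpha>"

definition jp_partial_quotient ::
    "nat \<Rightarrow> (nat \<Rightarrow> 'p::prime_card padic) \<Rightarrow> nat \<Rightarrow> nat \<Rightarrow> rat" where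
  "jp_partial_quotient m \<alpha> n i = browkin_s (jp_complete_quotient m \<alpha> n i)"

text \<open>
  Because \<open>x / 0 = 0\<close>, \<open>jp_complete_quotient\<close> is total. Up to the first \<open>n\<close> at which the stopping
  condition holds it agrees with the algorithm, so the algorithm runs forever iff the condition
  holds for no \<open>n\<close>.
\<close>

definition jp_never_stops :: "nat \<Rightarrow> (nat \<Rightarrow> 'p::prime_card padic) \<Rightarrow> bool" where
  "jp_never_stops m \<alpha> \<longleftrightarrow>
     (\<forall>n. jp_complete_quotient m \<alpha> n m \<noteq> of_rat (jp_partial_quotient m \<alpha> n m))"

definition jp_purely_periodic :: "nat \<Rightarrow> (nat \<Rightarrow> 'p::prime_card padic) \<Rightarrow> nat \<Rightarrow> bool" where
  "jp_purely_periodic m \<alpha> N \<longleftrightarrow>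
     N > 0 \<and> jp_never_stops m \<alpha> \<and>
     (\<forall>k. \<forall>i\<in>{1..m}. jp_partial_quotient m \<alpha> (k + N) i = jp_partial_quotient m \<alpha> k i)"

text \<open>
  Rows and columns are numbered from \<open>0\<close>, so \<open>a (i + 1)\<close> stands in row \<open>i\<close> of the first column.
  \<open>jp_char_poly\<close> is the characteristic polynomial of a purely periodic continued fraction of period \<open>1\<close>;
  it is not meant for longer periods.
\<close>

definition jp_matrix :: "nat \<Rightarrow> (nat \<Rightarrow> rat) \<Rightarrow> rat mat" where
  "jp_matrix m a = mat (m + 1) (m + 1) (\<lambda>(i, j).
     if j = 0 then (if i < m then a (i + 1) else 1)
     else if j = i + 1 then 1 else 0)"

definition jp_char_poly :: "nat \<Rightarrow> (nat \<Rightarrow> 'p::prime_card padic) \<Rightarrow> rat poly" where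
  "jp_char_poly m \<alpha> = char_poly (jp_matrix m (jp_partial_quotient m \<alpha> 0))"

definition is_subfield :: "'a::field set \<Rightarrow> bool" where
  "is_subfield K \<longleftrightarrow> 1 \<in> K \<and> (\<forall>x\<in>K. \<forall>y\<in>K. x - y \<in> K \<and> x * y \<in> K) \<and> (\<forall>x\<in>K. inverse x \<in> K)"

text \<open>
  In characteristic \<open>0\<close> every subfield contains the rationals, so the least subfield containing \<open>S\<close>
  is \<open>\<rat>(S)\<close>.
\<close>

definition rat_adjoin :: "'a::field_char_0 set \<Rightarrow> 'a set" where
  "rat_adjoin S = is_subfield hull S"

lemma vector_space_of_rat: "vector_space (\<lambda>(q::rat) (x::'a::field_char_0). of_rat q * x)"
  by unfold_locales (auto simp: of_rat_add of_rat_mult algebra_simps)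

text \<open>
  The value is \<open>0\<close> for extensions of infinite degree.
\<close>

definition rat_degree :: "'a::field_char_0 set \<Rightarrow> nat" where
  "rat_degree K = vector_space.dim (\<lambda>(q::rat) (x::'a). of_rat q * x) K"

end

theory Submission
  imports Defs "HOL-Computational_Algebra.Field_as_Ring"
begin

text \<open>
  Write \<open>a i\<close> for the constant partial quotients. By the shape of the matrix, the
  characteristic polynomial is \<open>X^(m+1) - a 1 X^m - \<dots> - a m X - 1\<close>; its eigenvectors are the lists of
  intermediate values of the Horner scheme, so \<open>x\<close> is a root iff the scheme closes up
  (\<open>char_poly_jp_matrix_root_iff\<close>). Three features of the \<open>a i\<close> exclude a rational root \<open>r\<close>. They have
  denominators that are powers of \<open>p\<close>, and the leading and constant coefficients are units, so
  \<open>r\<close> is \<open>\<plusminus> p^k\<close> for an integer \<open>k\<close> (\<open>horner_rational_root\<close>). Their ordinary absolute value is below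
  \<open>p / 2\<close>, which rules out \<open>\<bar>r\<bar> \<ge> p\<close> and \<open>\<bar>r\<bar> \<le> 1 / p\<close> (\<open>horner_no_large_root\<close>,
  \<open>horner_no_small_root\<close>). Finally \<open>a 1\<close> is strictly larger \<open>p\<close>-adically than \<open>1\<close> and than the other
  \<open>a i\<close> (\<open>period_one_dominant\<close>), so at a \<open>p\<close>-adic unit the term \<open>a 1 r^m\<close> cannot be cancelled and
  \<open>r = \<plusminus> 1\<close> is impossible (\<open>horner_no_padic_unit_root\<close>).

  For \<open>m = 2\<close> a cubic without rational root is irreducible. The link to the field generated by the
  limits is that the input of a period one expansion is a fixed point of the algorithm: the inverse
  of the algorithm step with given partial quotients contracts \<open>p\<close>-adic distances, and both
  \<open>\<alpha>\<close> and its image under the step have the same partial quotients (\<open>period_one_fixed_point\<close>). The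
  fixed point equations say that \<open>\<alpha> 1\<close> is a root of the characteristic polynomial and that
  \<open>\<alpha> 2 = \<alpha> 1 (\<alpha> 1 - a 1)\<close>. Thus \<open>\<rat>(\<alpha> 1, \<alpha> 2) = \<rat>(\<alpha> 1)\<close> has the degree of that polynomial.
\<close>

section \<open>Simple algebraic extensions of the rationals\<close>

text \<open>
  One factor of a proper factorization of a cubic is linear.
\<close>

lemma irreducible_cubicI:
  fixes f :: "'a::field poly"
  assumes deg: "degree f = 3" and no_root: "\<And>x. poly f x \<noteq> 0"
  shows "irreducible f"
proof (rule irreducibleI)
  show "f \<noteq> 0" "\<not> f dvd 1"
    using deg by (auto simp: is_unit_iff_degree)
next
  fix g h assume f: "f = g * h"
  show "g dvd 1 \<or> h dvd 1"
  proof (rule ccontr)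
    assume "\<not> ?thesis"
    moreover have nz: "g \<noteq> 0" "h \<noteq> 0"
      using f deg by auto
    ultimately have "degree g \<noteq> 0" "degree h \<noteq> 0"
      by (auto simp: is_unit_iff_degree)
    moreover have "degree g + degree h = 3"
      using deg nz by (simp add: f degree_mult_eq)
    ultimately have "degree g = 1 \<or> degree h = 1"
      by arith
    moreover have "\<exists>x. poly q x = 0" if "degree q = 1" for q :: "'a poly"
    proof -
      obtain a b where "q = [:b, a:]" "a \<noteq> 0"
        using \<open>degree q = 1\<close> by (metis degree1_coeffs)
      thus ?thesis
        by (intro exI[of _ "- b / a"]) simp
    qed
    ultimately obtain x where "poly g x = 0 \<or> poly h x = 0"
      by blast
    thus False
      using no_root[of x] by (auto simp: f)
  qed
qed

definition rat_eval :: "'a::field_char_0 \<Rightarrow> rat poly \<Rightarrow> 'a" where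
  "rat_eval x g = poly (map_poly of_rat g) x"

lemma rat_eval_0 [simp]: "rat_eval x 0 = 0"
  and rat_eval_1 [simp]: "rat_eval x 1 = 1"
  and rat_eval_X [simp]: "rat_eval x [:0, 1:] = x"
  and rat_eval_pCons: "rat_eval x (pCons c g) = of_rat c + x * rat_eval x g"
  and rat_eval_add: "rat_eval x (g + h) = rat_eval x g + rat_eval x h"
  by (simp_all add: rat_eval_def of_rat_hom.map_poly_pCons_hom hom_distribs)

lemma rat_eval_smult: "rat_eval x (Polynomial.smult c g) = of_rat c * rat_eval x g"
  by (induction g) (simp_all add: rat_eval_pCons of_rat_mult distrib_left mult.assoc mult.left_commute)

lemma rat_eval_mult: "rat_eval x (g * h) = rat_eval x g * rat_eval x h"
  by (induction g) (simp_all add: rat_eval_pCons rat_eval_add rat_eval_smult distrib_right mult.assoc)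

lemma rat_eval_diff: "rat_eval x (g - h) = rat_eval x g - rat_eval x h"
  using rat_eval_add[of x "g - h" h] by simp

lemma rat_eval_sum: "rat_eval x (\<Sum>i\<in>I. g i) = (\<Sum>i\<in>I. rat_eval x (g i))"
  by (induction I rule: infinite_finite_induct) (simp_all add: rat_eval_add)

lemma rat_eval_monom: "rat_eval x (Polynomial.monom c i) = of_rat c * x ^ i"
  by (induction i) (simp_all add: monom_0 monom_Suc rat_eval_pCons)

lemma is_subfield_rat_eval:
  assumes "is_subfield K" "x \<in> K"
  shows "rat_eval x g \<in> K"
proof -
  have one: "1 \<in> K" and diff: "\<And>y z. y \<in> K \<Longrightarrow> z \<in> K \<Longrightarrow> y - z \<in> K"
    and mult: "\<And>y z. y \<in> K \<Longrightarrow> z \<in> K \<Longrightarrow> y * z \<in> K"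
    and inv: "\<And>y. y \<in> K \<Longrightarrow> inverse y \<in> K"
    using assms(1) by (auto simp: is_subfield_def)
  have zero: "0 \<in> K"
    using diff[OF one one] by simp
  have add: "y + z \<in> K" if "y \<in> K" "z \<in> K" for y z
    using diff[OF that(1) diff[OF zero that(2)]] by simp
  have nat: "of_nat n \<in> K" for n
    by (induction n) (auto intro: zero one add)
  have int: "of_int k \<in> K" for k
    by (cases k rule: int_cases2) (use nat diff[OF zero nat] in auto)
  have rat: "of_rat q \<in> K" for q
    by (cases q) (use mult[OF int inv[OF int]] in \<open>auto simp: of_rat_rat divide_inverse\<close>)
  show ?thesis
    by (induction g) (auto simp: rat_eval_pCons intro: zero rat add mult assms(2))
qed

text \<open>
  A polynomial that is not a multiple of \<open>f\<close> is coprime to \<open>f\<close>, and evaluating a Bezout identity at the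
  root \<open>x\<close> of \<open>f\<close> produces the inverse. In particular, no such polynomial vanishes at \<open>x\<close>.
\<close>

lemma irreducible_root_eval_invertible:
  assumes irr: "irreducible f" and root: "rat_eval x f = 0" and g: "\<not> f dvd g"
  shows "\<exists>u. rat_eval x u * rat_eval x g = 1"
proof -
  have "prime_elem f"
    using irr by (rule irreducible_imp_prime_elem)
  hence "coprime f g"
    using g by (rule prime_elem_imp_coprime)
  then obtain v u where "v * f + u * g = 1"
    by (metis bezout_coefficients_fst_snd coprime_imp_gcd_eq_1)
  hence "rat_eval x (v * f + u * g) = 1"
    by simp
  thus ?thesis
    using root by (auto simp: rat_eval_add rat_eval_mult)
qed

text \<open>
  Over an algebraic \<open>x\<close> the ring of polynomial expressions is already closed under inverses.
\<close>

lemma rat_adjoin_algebraic: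
  assumes irr: "irreducible f" and root: "rat_eval x f = 0"
  shows "rat_adjoin {x} = range (rat_eval x)"
  unfolding rat_adjoin_def
proof (rule hull_unique)
  show "{x} \<subseteq> range (rat_eval x)"
    by (auto intro: range_eqI[of _ _ "[:0, 1:]"])
  show "range (rat_eval x) \<subseteq> K" if "{x} \<subseteq> K" "is_subfield K" for K
    using is_subfield_rat_eval that by auto
  show "is_subfield (range (rat_eval x))"
    unfolding is_subfield_def
  proof (intro conjI ballI)
    show "1 \<in> range (rat_eval x)"
      by (metis rat_eval_1 rangeI)
  next
    fix y assume "y \<in> range (rat_eval x)"
    then obtain g where y: "y = rat_eval x g"
      by blast
    show "inverse y \<in> range (rat_eval x)"
    proof (cases "f dvd g")
      case True
      hence "y = 0"
        using root by (auto simp: y rat_eval_mult)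
      thus ?thesis
        by (metis inverse_zero rat_eval_0 rangeI)
    next
      case False
      then obtain u where "rat_eval x u * y = 1"
        using irreducible_root_eval_invertible[OF irr root] y by blast
      thus ?thesis
        by (metis inverse_unique mult.commute rangeI)
    qed
  next
    fix y z assume "y \<in> range (rat_eval x)" "z \<in> range (rat_eval x)"
    then obtain g h where "y = rat_eval x g" "z = rat_eval x h"
      by blast
    thus "y - z \<in> range (rat_eval x)" "y * z \<in> range (rat_eval x)"
      by (simp_all flip: rat_eval_diff rat_eval_mult)
  qed
qed

text \<open>
  The powers of \<open>x\<close> below \<open>degree f\<close> form a basis: they span because remainders modulo \<open>f\<close> have the same
  value at \<open>x\<close>, and a linear relation between them would be a nonzero polynomial of degree smaller
  than that of \<open>f\<close> vanishing at \<open>x\<close>.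
\<close>

lemma rat_degree_adjoin_algebraic:
  assumes irr: "irreducible f" and root: "rat_eval x f = 0"
  shows "rat_degree (rat_adjoin {x}) = degree f"
proof -
  have f0: "degree f > 0"
    using irr by (auto simp: irreducible_def is_unit_iff_degree)
  have no_smaller: "g = 0" if "rat_eval x g = 0" "degree g < degree f" for g
  proof (rule ccontr)
    assume "g \<noteq> 0"
    hence "\<not> f dvd g"
      using that(2) dvd_imp_degree_le[of f g] by linarith
    then obtain u where "rat_eval x u * rat_eval x g = 1"
      using irreducible_root_eval_invertible[OF irr root] by blast
    thus False
      by (simp add: that(1))
  qed
  have eval_sum: "rat_eval x (\<Sum>i<degree f. Polynomial.monom (c i) i) = (\<Sum>i<degree f. of_rat (c i) * x ^ i)" for c
    by (simp add: rat_eval_sum rat_eval_monom)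
  have pow_eval: "x ^ i = rat_eval x (Polynomial.monom 1 i)" for i
    by (simp add: rat_eval_monom)
  have lin: "c i = 0" if "(\<Sum>i<degree f. of_rat (c i) * x ^ i) = 0" "i < degree f" for c i
  proof -
    have "degree (\<Sum>i<degree f. Polynomial.monom (c i) i) < degree f"
      using f0 by (intro degree_sum_less) (auto intro: le_less_trans[OF degree_monom_le])
    hence "(\<Sum>i<degree f. Polynomial.monom (c i) i) = 0"
      using no_smaller that(1) by (simp add: eval_sum)
    hence "Polynomial.coeff (\<Sum>i<degree f. Polynomial.monom (c i) i) i = 0"
      by simp
    thus ?thesis
      using that(2) by (simp add: coeff_sum)
  qed
  have inj: "inj_on (\<lambda>i. x ^ i) {..<degree f}"
  proof (rule inj_onI)
    fix i j assume ij: "i \<in> {..<degree f}" "j \<in> {..<degree f}" "x ^ i = x ^ j"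
    have "rat_eval x (Polynomial.monom 1 i - Polynomial.monom 1 j) = 0"
      using ij(3) by (simp add: rat_eval_diff flip: pow_eval)
    moreover have "degree (Polynomial.monom 1 i - Polynomial.monom (1::rat) j) < degree f"
      using ij by (intro degree_diff_less) (auto simp: degree_monom_eq)
    ultimately have "Polynomial.monom 1 i = Polynomial.monom (1::rat) j"
      using no_smaller by fastforce
    thus "i = j"
      by (simp add: monom_eq_iff')
  qed
  define B where "B = (\<lambda>i. x ^ i) ` {..<degree f}"
  interpret V: vector_space "\<lambda>(q::rat) (y::'a). of_rat q * y"
    by (rule vector_space_of_rat)
  have "V.dim (range (rat_eval x)) = card B"
  proof (rule V.dim_unique)
    show "B \<subseteq> range (rat_eval x)"
      by (auto simp: B_def pow_eval)
    have span: "rat_eval x g \<in> V.span B" for g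
    proof -
      have "rat_eval x g = rat_eval x (g mod f)"
        using rat_eval_add[of x "g mod f" "g div f * f"] root by (simp add: rat_eval_mult)
      also have "g mod f = (\<Sum>i<degree f. Polynomial.monom (Polynomial.coeff (g mod f) i) i)"
      proof (rule poly_eqI)
        fix n
        have "Polynomial.coeff (g mod f) n = 0" if "n \<ge> degree f"
        proof (cases "g mod f = 0")
          case False
          hence "degree (g mod f) < n"
            using degree_mod_less'[of f g] f0 that by fastforce
          thus ?thesis
            by (rule coeff_eq_0)
        qed simp
        thus "Polynomial.coeff (g mod f) n = Polynomial.coeff (\<Sum>i<degree f. Polynomial.monom (Polynomial.coeff (g mod f) i) i) n"
          by (auto simp: coeff_sum)
      qed
      also have "rat_eval x \<dots> = (\<Sum>i<degree f. of_rat (Polynomial.coeff (g mod f) i) * x ^ i)"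
        by (rule eval_sum)
      also have "\<dots> \<in> V.span B"
        by (intro V.span_sum V.span_scale V.span_base) (auto simp: B_def)
      finally show "rat_eval x g \<in> V.span B" .
    qed
    show "range (rat_eval x) \<subseteq> V.span B"
      by (rule image_subsetI) (rule span)
    show "V.independent B"
    proof (rule V.independent_if_scalars_zero)
      fix c y assume c: "(\<Sum>y\<in>B. of_rat (c y) * y) = 0" and "y \<in> B"
      then obtain i where i: "i < degree f" "y = x ^ i"
        by (auto simp: B_def)
      have "(\<Sum>i<degree f. of_rat (c (x ^ i)) * x ^ i) = 0"
        using c by (simp add: B_def sum.reindex[OF inj])
      thus "c y = 0"
        using lin[of "\<lambda>i. c (x ^ i)"] i by simp
    qed (simp add: B_def)
  qed simp
  also have "card B = degree f"
    by (simp add: B_def card_image[OF inj])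
  finally show ?thesis
    by (simp add: rat_degree_def rat_adjoin_algebraic[OF assms])
qed

section \<open>The characteristic polynomial as a Horner scheme\<close>

text \<open>
  \<open>horner a x i\<close> is \<open>x^i - a 1 x^(i-1) - \<dots> - a i\<close>.
  The absolute values of a root are estimated along the recursion, one coefficient at a time.
\<close>

primrec horner :: "(nat \<Rightarrow> 'a::field) \<Rightarrow> 'a \<Rightarrow> nat \<Rightarrow> 'a" where
  "horner a x 0 = 1"
| "horner a x (Suc i) = x * horner a x i - a (Suc i)"

lemma jp_matrix_carrier: "jp_matrix m a \<in> carrier_mat (Suc m) (Suc m)"
  by (simp add: jp_matrix_def)

lemma jp_matrix_mult_vec:
  fixes v :: "nat \<Rightarrow> 'a::field_char_0"
  assumes "i \<le> m"
  shows "(map_mat of_rat (jp_matrix m a) *\<^sub>v vec (Suc m) v) $ i =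
    (if i < m then of_rat (a (Suc i)) * v 0 + v (Suc i) else v 0)"
proof -
  have "(map_mat of_rat (jp_matrix m a) *\<^sub>v vec (Suc m) v) $ i
      = (\<Sum>j<Suc m. of_rat (jp_matrix m a $$ (i, j)) * v j)"
    using assms jp_matrix_carrier[of m a]
    by (auto simp: scalar_prod_def atLeast0LessThan intro!: sum.cong)
  also have "\<dots> = of_rat (jp_matrix m a $$ (i, 0)) * v 0 + 
      (\<Sum>j<m. if j = i then v (Suc j) else 0)"
    unfolding sum.lessThan_Suc_shift using assms
    by (intro arg_cong2[where f = "(+)"] sum.cong refl) (auto simp: jp_matrix_def)
  also have "\<dots> = (if i < m then of_rat (a (Suc i)) * v 0 + v (Suc i) else v 0)"
    using assms by (auto simp: jp_matrix_def)
  finally show ?thesis .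
qed

text \<open>
  Read row by row, the eigenvector equation for \<open>v\<close> is the recursion of the Horner scheme scaled by
  \<open>v 0\<close>, and the last row is the closing condition. This replaces the expansion of a determinant.
\<close>

lemma char_poly_jp_matrix_root_iff:
  fixes x :: "'a::field_char_0"
  shows "poly (map_poly of_rat (char_poly (jp_matrix m a))) x = 0 \<longleftrightarrow>
    x * horner (\<lambda>i. of_rat (a i)) x m = 1"
    (is "_ \<longleftrightarrow> x * ?h m = 1")
proof -
  define A where "A = (map_mat of_rat (jp_matrix m a) :: 'a mat)"
  have A: "A \<in> carrier_mat (Suc m) (Suc m)"
    using jp_matrix_carrier by (simp add: A_def)
  have eigen_iff: "A *\<^sub>v vec (Suc m) v = x \<cdot>\<^sub>v vec (Suc m) v \<longleftrightarrow>
      v 0 = x * v m \<and> (\<forall>i<m. v (Suc i) = x * v i - of_rat (a (Suc i)) * v 0)" for v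
  proof -
    have "A *\<^sub>v vec (Suc m) v = x \<cdot>\<^sub>v vec (Suc m) v \<longleftrightarrow>
        (\<forall>i\<le>m. (A *\<^sub>v vec (Suc m) v) $ i = x * v i)"
      using A by (auto simp: vec_eq_iff less_Suc_eq_le)
    also have "\<dots> \<longleftrightarrow> (\<forall>i\<le>m. (if i < m then of_rat (a (Suc i)) * v 0 + v (Suc i) else v 0) = x * v i)"
      unfolding A_def by (simp add: jp_matrix_mult_vec cong: conj_cong)
    also have "\<dots> \<longleftrightarrow> v 0 = x * v m \<and> (\<forall>i<m. of_rat (a (Suc i)) * v 0 + v (Suc i) = x * v i)"
      by (auto simp: le_less)
    also have "\<dots> \<longleftrightarrow> v 0 = x * v m \<and> (\<forall>i<m. v (Suc i) = x * v i - of_rat (a (Suc i)) * v 0)"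
      by (auto simp: algebra_simps)
    finally show ?thesis .
  qed
  have "poly (map_poly of_rat (char_poly (jp_matrix m a))) x = 0 \<longleftrightarrow> poly (char_poly A) x = 0"
    unfolding A_def by (simp add: of_rat_hom.char_poly_hom[OF jp_matrix_carrier])
  also have "\<dots> \<longleftrightarrow> eigenvalue A x"
    by (simp add: eigenvalue_root_char_poly[OF A])
  also have "\<dots> \<longleftrightarrow> x * ?h m = 1"
  proof
    assume "eigenvalue A x"
    then obtain w where w: "w \<in> carrier_vec (Suc m)" "w \<noteq> 0\<^sub>v (Suc m)" "A *\<^sub>v w = x \<cdot>\<^sub>v w"
      using A by (auto simp: eigenvalue_def eigenvector_def)
    define v where "v = (\<lambda>i. w $ i)"
    have wv: "w = vec (Suc m) v"
      using w(1) by (auto simp: v_def)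
    have v: "v 0 = x * v m" "\<And>i. i < m \<Longrightarrow> v (Suc i) = x * v i - of_rat (a (Suc i)) * v 0"
      using w(3) eigen_iff by (auto simp: wv)
    have vh: "v i = ?h i * v 0" if "i \<le> m" for i
      using that
    proof (induction i)
      case (Suc i)
      thus ?case
        using v(2)[of i] by (simp add: algebra_simps)
    qed simp
    \<comment> \<open>The first entry determines the others, so it cannot vanish.\<close>
    have "v 0 \<noteq> 0"
    proof
      assume "v 0 = 0"
      hence "v i = 0" if "i \<le> m" for i
        using vh[OF that] by simp
      hence "w = 0\<^sub>v (Suc m)"
        by (auto simp: wv)
      thus False
        using w(2) by simp
    qed
    moreover have "x * ?h m * v 0 = v 0"
      by (simp only: mult.assoc vh[OF order.refl, symmetric] v(1)[symmetric])
    ultimately show "x * ?h m = 1"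
      by simp
  next
    assume "x * ?h m = 1"
    hence "A *\<^sub>v vec (Suc m) ?h = x \<cdot>\<^sub>v vec (Suc m) ?h"
      unfolding eigen_iff by simp
    moreover have "vec (Suc m) ?h \<noteq> 0\<^sub>v (Suc m)"
      by (auto simp: vec_eq_iff intro!: exI[of _ 0])
    ultimately have "eigenvector A (vec (Suc m) ?h) x"
      using A by (simp add: eigenvector_def)
    thus "eigenvalue A x"
      by (auto simp: eigenvalue_def)
  qed
  finally show ?thesis .
qed

text \<open>
  This is the rational root theorem for coefficients in \<open>\<int>[1/p]\<close>: numerator and denominator divide the
  constant and the leading coefficient up to powers of \<open>p\<close>. Both are \<open>1\<close> up to sign, so what remains
  is a power of \<open>p\<close>.
\<close>

lemma horner_rational_root:
  fixes a :: "nat \<Rightarrow> rat"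
  assumes p: "prime p"
    and a: "\<And>i. 1 \<le> i \<Longrightarrow> i \<le> m \<Longrightarrow> \<exists>n. of_nat p ^ n * a i \<in> \<int>"
    and root: "r * horner a r m = 1"
  shows "\<exists>s t. \<bar>r\<bar> = of_nat p ^ s / of_nat p ^ t"
proof -
  have "\<exists>n. \<forall>i\<in>{1..m}. of_nat p ^ n * a i \<in> \<int>"
  proof -
    obtain N where N: "\<And>i. i \<in> {1..m} \<Longrightarrow> of_nat p ^ N i * a i \<in> \<int>"
      using a by (metis atLeastAtMost_iff)
    have "of_nat p ^ (\<Sum>i\<in>{1..m}. N i) * a i \<in> \<int>" if "i \<in> {1..m}" for i
    proof -
      have "(\<Sum>i\<in>{1..m}. N i) = (\<Sum>i\<in>{1..m} - {i}. N i) + N i"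
        using that by (simp add: sum.remove)
      hence "of_nat p ^ (\<Sum>i\<in>{1..m}. N i) * a i = of_nat p ^ (\<Sum>i\<in>{1..m} - {i}. N i) * (of_nat p ^ N i * a i)"
        by (simp add: power_add)
      thus ?thesis
        using Ints_mult[OF Ints_power[OF Ints_of_nat] N[OF that]] by metis
    qed
    thus ?thesis
      by blast
  qed
  then obtain n where n: "\<And>i. i \<in> {1..m} \<Longrightarrow> of_nat p ^ n * a i \<in> \<int>"
    by blast
  obtain c d where cd: "quotient_of r = (c, d)"
    by fastforce
  have d: "d > 0" "coprime c d" and r: "r = of_int c / of_int d"
    using quotient_of_denom_pos[OF cd] quotient_of_coprime[OF cd] quotient_of_div[OF cd] by auto
  \<comment> \<open>Clearing denominators, the Horner scheme becomes integral and, modulo \<open>d\<close>, only its leading term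
    \<open>c ^ i * p ^ n\<close> survives. The congruence is what yields that \<open>d\<close> divides \<open>p ^ n\<close>.\<close>
  have int: "\<exists>z. of_nat p ^ n * of_int d ^ i * horner a r i = of_int z \<and> d dvd z - c ^ i * int p ^ n"
    if "i \<le> m" for i
    using that
  proof (induction i)
    case 0
    show ?case
      by (intro exI[of _ "int p ^ n"]) simp
  next
    case (Suc i)
    then obtain z where z: "of_nat p ^ n * of_int d ^ i * horner a r i = of_int z"
      "d dvd z - c ^ i * int p ^ n"
      by auto
    obtain b where b: "of_nat p ^ n * a (Suc i) = of_int b"
      using n[of "Suc i"] Suc.prems by (auto elim: Ints_cases)
    have "of_nat p ^ n * of_int d ^ Suc i * horner a r (Suc i)
        = of_int c * (of_nat p ^ n * of_int d ^ i * horner a r i)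
          - of_int d ^ Suc i * (of_nat p ^ n * a (Suc i))"
      using d(1) by (simp add: r field_simps)
    also have "\<dots> = of_int (c * z - d ^ Suc i * b)"
      by (simp only: z b of_int_mult of_int_diff of_int_power)
    finally have "of_nat p ^ n * of_int d ^ Suc i * horner a r (Suc i) = of_int (c * z - d ^ Suc i * b)" .
    moreover have "c * z - d ^ Suc i * b - c ^ Suc i * int p ^ n
        = c * (z - c ^ i * int p ^ n) - d * (d ^ i * b)"
      by (simp add: algebra_simps)
    hence "d dvd c * z - d ^ Suc i * b - c ^ Suc i * int p ^ n"
      using dvd_diff[OF dvd_mult[OF z(2)] dvd_triv_left] by metis
    ultimately show ?case
      by blast
  qed
  obtain z where z: "of_nat p ^ n * of_int d ^ m * horner a r m = of_int z" "d dvd z - c ^ m * int p ^ n"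
    using int by blast
  have "(of_int (int p ^ n * d ^ Suc m) :: rat) = of_nat p ^ n * of_int d ^ Suc m * (r * horner a r m)"
    by (simp add: root)
  also have "\<dots> = of_int c * (of_nat p ^ n * of_int d ^ m * horner a r m)"
    using d(1) by (simp add: r)
  also have "\<dots> = of_int (c * z)"
    by (simp add: z(1))
  finally have eq: "int p ^ n * d ^ Suc m = c * z"
    by (simp only: of_int_eq_iff)
  have c_dvd: "c dvd int p ^ n"
  proof -
    have "c dvd int p ^ n * d ^ Suc m"
      unfolding eq by simp
    moreover have "coprime c (d ^ Suc m)"
      using d(2) by (rule coprime_power_right_iff[THEN iffD2, OF disjI1])
    ultimately show ?thesis
      by (simp only: coprime_dvd_mult_left_iff)
  qed
  have d_dvd: "d dvd int p ^ n"
  proof -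
    have "d dvd c * z"
      unfolding eq[symmetric] by simp
    hence "d dvd z"
      using d(2) by (simp add: coprime_dvd_mult_right_iff coprime_commute)
    hence "d dvd c ^ m * int p ^ n"
      using dvd_diff[OF _ z(2)] by fastforce
    moreover have "coprime d (c ^ m)"
      using d(2) by (simp add: coprime_commute)
    ultimately show ?thesis
      by (simp only: coprime_dvd_mult_right_iff)
  qed
  have power: "\<exists>s. \<bar>y\<bar> = int p ^ s" if "y dvd int p ^ n" for y
  proof -
    have "nat \<bar>y\<bar> dvd p ^ n"
      using that by (simp flip: of_nat_power add: nat_abs_dvd_iff)
    then obtain s where "nat \<bar>y\<bar> = p ^ s"
      using divides_primepow_nat[OF p] by blast
    thus ?thesis
      by (metis abs_ge_zero nat_0_le of_nat_power)
  qed
  obtain s where s: "\<bar>c\<bar> = int p ^ s"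
    using power[OF c_dvd] by blast
  obtain t where t: "\<bar>d\<bar> = int p ^ t"
    using power[OF d_dvd] by blast
  have "\<bar>r\<bar> = of_int \<bar>c\<bar> / of_int \<bar>d\<bar>"
    by (simp add: r)
  hence "\<bar>r\<bar> = of_nat p ^ s / of_nat p ^ t"
    by (simp only: s t of_int_power of_int_of_nat_eq)
  thus ?thesis
    by blast
qed

text \<open>
  Multiplying a value of modulus at least \<open>1\<close> by \<open>x\<close> gives at least \<open>B\<close>, and subtracting a coefficient of
  modulus at most \<open>B / 2\<close> leaves at least \<open>B / 2 \<ge> 1\<close>. So the values never drop below \<open>1\<close>, and the
  scheme does not close.
\<close>

lemma horner_no_large_root:
  fixes a :: "nat \<Rightarrow> 'a::linordered_field"
  assumes "B \<ge> 2" "\<And>i. 1 \<le> i \<Longrightarrow> i \<le> m \<Longrightarrow> 2 * \<bar>a i\<bar> \<le> B" "\<bar>x\<bar> \<ge> B"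
  shows "x * horner a x m \<noteq> 1"
proof
  assume root: "x * horner a x m = 1"
  have "\<bar>horner a x i\<bar> \<ge> 1" if "i \<le> m" for i
    using that
  proof (induction i)
    case (Suc i)
    have "\<bar>x\<bar> * 1 \<le> \<bar>x\<bar> * \<bar>horner a x i\<bar>"
      using Suc by (intro mult_left_mono) auto
    also have "\<dots> = \<bar>x * horner a x i\<bar>"
      by (simp add: abs_mult)
    finally have "B \<le> \<bar>x * horner a x i\<bar>"
      using assms(3) by simp
    moreover have "2 * \<bar>a (Suc i)\<bar> \<le> B"
      using Suc.prems by (intro assms(2)) auto
    ultimately show ?case
      using assms(1) abs_triangle_ineq2[of "x * horner a x i" "a (Suc i)"] by simp
  qed simp
  hence "\<bar>x\<bar> * 1 \<le> \<bar>x\<bar> * \<bar>horner a x m\<bar>"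
    by (intro mult_left_mono) auto
  also have "\<dots> = 1"
    using root by (simp flip: abs_mult)
  finally show False
    using assms by simp
qed

text \<open>
  The same argument run backwards: closing requires the last value to be \<open>1 / x\<close>, of modulus at least
  \<open>B\<close>, and a value of modulus at least \<open>B\<close> forces the same for its predecessor, down to the initial
  value \<open>1\<close>.
\<close>

lemma horner_no_small_root:
  fixes a :: "nat \<Rightarrow> 'a::linordered_field"
  assumes "B \<ge> 2" "\<And>i. 1 \<le> i \<Longrightarrow> i \<le> m \<Longrightarrow> 2 * \<bar>a i\<bar> \<le> B" "B * \<bar>x\<bar> \<le> 1"
  shows "x * horner a x m \<noteq> 1"
proof
  assume root: "x * horner a x m = 1"
  have step: "\<bar>y\<bar> \<ge> B" if "\<bar>x * y\<bar> \<ge> 1" for y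
  proof -
    have "B * 1 \<le> B * (\<bar>x\<bar> * \<bar>y\<bar>)"
      using that assms(1) by (intro mult_left_mono) (auto simp: abs_mult)
    also have "\<dots> \<le> 1 * \<bar>y\<bar>"
      unfolding mult.assoc[symmetric] using assms(3) by (intro mult_right_mono) auto
    finally show ?thesis
      by simp
  qed
  have "\<bar>horner a x i\<bar> \<ge> B" if "i \<le> m" for i
    using that
  proof (induction i rule: inc_induct)
    case base
    show ?case
      by (rule step) (simp add: root)
  next
    case (step i)
    have "B \<le> \<bar>horner a x (Suc i)\<bar>" "2 * \<bar>a (Suc i)\<bar> \<le> B"
      using step by (auto intro: assms(2))
    moreover have "x * horner a x i = horner a x (Suc i) + a (Suc i)"
      by simp
    ultimately have "\<bar>x * horner a x i\<bar> \<ge> 1"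
      using assms(1) by linarith
    thus ?case
      by (rule \<open>\<And>y. \<bar>x * y\<bar> \<ge> 1 \<Longrightarrow> \<bar>y\<bar> \<ge> B\<close>)
  qed
  from this[of 0] show False
    using assms(1) by simp
qed

text \<open>
  By the ultrametric inequality the first step lifts the value to the size of the dominating \<open>a 1\<close>;
  afterwards multiplication by a unit keeps the size and the smaller coefficients cannot
  diminish it.
\<close>

lemma horner_no_padic_unit_root:
  assumes p: "prime p" and m: "m \<ge> 1"
    and a1: "padic_abs p (a 1) > 1"
    and dom: "\<And>i. 1 < i \<Longrightarrow> i \<le> m \<Longrightarrow> padic_abs p (a i) < padic_abs p (a 1)"
    and x: "padic_abs p x = 1"
  shows "x * horner a x m \<noteq> 1"
proof
  assume root: "x * horner a x m = 1"
  have "padic_abs p (horner a x i) \<ge> padic_abs p (a 1)" if "1 \<le> i" "i \<le> m" for i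
    using that
  proof (induction i rule: dec_induct)
    case base
    have "padic_abs p (a 1) \<le> max (padic_abs p x) (padic_abs p (horner a x 1))"
      using padic_abs_diff[OF p, of x "horner a x 1"] by simp
    thus ?case
      using a1 x by simp
  next
    case (step i)
    have "padic_abs p (a 1) \<le> padic_abs p (x * horner a x i)"
      using step by (simp add: padic_abs_mult[OF p] x)
    also have "\<dots> \<le> max (padic_abs p (horner a x (Suc i))) (padic_abs p (a (Suc i)))"
      using padic_abs_add[OF p, of "horner a x (Suc i)" "a (Suc i)"] by simp
    finally show ?case
      using dom[of "Suc i"] step by (auto simp: le_max_iff_disj)
  qed
  from this[of m] have "padic_abs p (x * horner a x m) > 1"
    using m a1 by (simp add: padic_abs_mult[OF p] x)
  thus False
    by (simp add: root padic_abs_1[OF p])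
qed

section \<open>Approximation by the Browkin function\<close>

lemma padic_norm_one [simp]: "padic_norm 1 = 1"
  using padic_norm_power[of 0 0] by simp

lemma padic_norm_divide:
  "padic_norm (x / y) = padic_norm x / padic_norm y" for x y :: "'p::prime_card padic"
proof (cases "y = 0")
  case False
  have "padic_norm x = padic_norm (x / y) * padic_norm y"
    using False by (simp flip: padic_norm_mult)
  thus ?thesis
    using False by simp
qed simp

lemma padic_norm_diff:
  "padic_norm (x - y) \<le> max (padic_norm x) (padic_norm y)" for x y :: "'p::prime_card padic"
  using padic_norm_add[of x "- y"] by simp

lemma browkin_s_norm_diff:
  fixes \<alpha> :: "'p::prime_card padic"
  assumes "odd CARD('p)"
  shows "padic_norm (\<alpha> - of_rat (browkin_s \<alpha>)) \<le> 1 / real CARD('p)"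
  using browkin_expansion_exists[OF assms, of \<alpha>] browkin_expansion_norm_diff browkin_s_eq
  by metis

lemma browkin_s_bound:
  fixes \<alpha> :: "'p::prime_card padic"
  assumes "odd CARD('p)"
  shows "2 * \<bar>browkin_s \<alpha>\<bar> < of_nat CARD('p)"
proof -
  obtain k x where kx: "browkin_expansion \<alpha> k x"
    using browkin_expansion_exists[OF assms] by blast
  hence "2 * \<bar>x j\<bar> < int CARD('p)" if "j \<ge> k" for j
    using that by (simp add: browkin_expansion_def)
  thus ?thesis
    unfolding browkin_s_eq[OF kx] by (rule browkin_sum_bound[OF prime_card])
qed

lemma browkin_s_denominator:
  fixes \<alpha> :: "'p::prime_card padic"
  assumes "odd CARD('p)"
  shows "\<exists>n. of_nat CARD('p) ^ n * browkin_s \<alpha> \<in> \<int>"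
proof -
  obtain k x where kx: "browkin_expansion \<alpha> k x"
    using browkin_expansion_exists[OF assms] by blast
  define n where "n = nat (- k)"
  have "of_nat CARD('p) ^ n * (of_int (x j) * of_nat CARD('p) powi j) \<in> (\<int> :: rat set)"
    if j: "j \<in> {k..0}" for j
  proof -
    have "of_nat CARD('p) ^ n * of_nat CARD('p) powi j = (of_nat CARD('p) powi (int n + j) :: rat)"
      by (simp add: power_int_add)
    also have "\<dots> = of_nat CARD('p) ^ nat (int n + j)"
      using j by (simp add: power_int_def n_def)
    finally have "of_nat CARD('p) ^ n * (of_int (x j) * of_nat CARD('p) powi j)
        = (of_int (x j) * of_nat CARD('p) ^ nat (int n + j) :: rat)"
      by (simp only: mult.left_commute)
    thus ?thesis
      by (simp only: Ints_mult Ints_of_int Ints_power Ints_of_nat)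
  qed
  hence "of_nat CARD('p) ^ n * browkin_s \<alpha> \<in> \<int>"
    unfolding browkin_s_eq[OF kx] sum_distrib_left by (rule Ints_sum)
  thus ?thesis ..
qed

section \<open>Expansions of period one\<close>

text \<open>
  Appending the coordinate \<open>1\<close> at position \<open>m + 1\<close> gives the algorithm step for the indices \<open>i < m\<close> and
  the one for \<open>i = m\<close> the same shape.
\<close>

definition jp_homogeneous ::
    "nat \<Rightarrow> (nat \<Rightarrow> 'p::prime_card padic) \<Rightarrow> nat \<Rightarrow> nat \<Rightarrow> 'p padic" where
  "jp_homogeneous m \<alpha> n i = (if i = Suc m then 1 else jp_complete_quotient m \<alpha> n i)"

lemma period_one_partial_quotient:
  assumes "jp_purely_periodic m \<alpha> 1" "1 \<le> i" "i \<le> m"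
  shows "jp_partial_quotient m \<alpha> n i = jp_partial_quotient m \<alpha> 0 i"
proof (induction n)
  case (Suc n)
  have "jp_partial_quotient m \<alpha> (n + 1) i = jp_partial_quotient m \<alpha> n i"
    using assms by (simp add: jp_purely_periodic_def)
  thus ?case
    using Suc by simp
qed simp

text \<open>
  The algorithm step solved for its argument.
\<close>

lemma period_one_recurrence:
  assumes "jp_purely_periodic m \<alpha> 1" "m \<ge> 1"
  shows "jp_homogeneous m \<alpha> (Suc n) 1 \<noteq> 0"
    and "1 \<le> i \<Longrightarrow> i \<le> m \<Longrightarrow> jp_homogeneous m \<alpha> n i = of_rat (jp_partial_quotient m \<alpha> 0 i)
      + jp_homogeneous m \<alpha> (Suc n) (Suc i) / jp_homogeneous m \<alpha> (Suc n) 1"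
proof -
  define z where "z = jp_complete_quotient m \<alpha>"
  define a where "a = jp_partial_quotient m \<alpha> 0"
  have s: "browkin_s (z n i) = a i" if "1 \<le> i" "i \<le> m" for i
    using period_one_partial_quotient[OF assms(1) that, of n]
    by (simp add: z_def a_def jp_partial_quotient_def)
  have "z n m \<noteq> of_rat (browkin_s (z n m))"
    using assms(1)
    by (simp add: jp_purely_periodic_def jp_never_stops_def jp_partial_quotient_def z_def)
  hence nz: "z n m - of_rat (a m) \<noteq> 0"
    using s[of m] assms(2) by simp
  have z_Suc: "z (Suc n) = jp_step m (z n)"
    by (simp add: z_def jp_complete_quotient_def)
  have z1: "z (Suc n) 1 = 1 / (z n m - of_rat (a m))"
    using s[of m] assms(2) by (simp add: z_Suc jp_step_def)
  have zi: "z (Suc n) (Suc i) = (z n i - of_rat (a i)) / (z n m - of_rat (a m))"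
    if "1 \<le> i" "i < m" for i
    using s[of m] s[of i] that by (simp add: z_Suc jp_step_def)
  have H1: "jp_homogeneous m \<alpha> (Suc n) 1 = 1 / (z n m - of_rat (a m))"
    using z1 assms(2) by (simp add: jp_homogeneous_def z_def)
  show "jp_homogeneous m \<alpha> (Suc n) 1 \<noteq> 0"
    unfolding H1 using nz by simp
  assume i: "1 \<le> i" "i \<le> m"
  have "jp_homogeneous m \<alpha> (Suc n) (Suc i)
      = (z n i - of_rat (a i)) / (z n m - of_rat (a m))"
    using zi[of i] i nz by (cases "i = m") (auto simp: jp_homogeneous_def z_def)
  hence "jp_homogeneous m \<alpha> (Suc n) (Suc i) / jp_homogeneous m \<alpha> (Suc n) 1 = z n i - of_rat (a i)"
    unfolding H1 using nz by simp
  thus "jp_homogeneous m \<alpha> n i = of_rat (jp_partial_quotient m \<alpha> 0 i)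
      + jp_homogeneous m \<alpha> (Suc n) (Suc i) / jp_homogeneous m \<alpha> (Suc n) 1"
    using i by (simp add: jp_homogeneous_def flip: z_def a_def)
qed

lemma period_one_norm_diff:
  fixes \<alpha> :: "nat \<Rightarrow> 'p::prime_card padic"
  assumes "odd CARD('p)" "jp_purely_periodic m \<alpha> 1" "1 \<le> i" "i \<le> m"
  shows "padic_norm (jp_homogeneous m \<alpha> n i - of_rat (jp_partial_quotient m \<alpha> 0 i))
    \<le> 1 / real CARD('p)"
proof -
  have "browkin_s (jp_complete_quotient m \<alpha> n i) = jp_partial_quotient m \<alpha> 0 i"
    using period_one_partial_quotient[OF assms(2-4), of n] unfolding jp_partial_quotient_def .
  thus ?thesis
    using browkin_s_norm_diff[OF assms(1), of "jp_complete_quotient m \<alpha> n i"] assms(4)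
    by (simp add: jp_homogeneous_def)
qed

text \<open>
  After one step the first coordinate is the reciprocal of a number of norm at most \<open>1 / p\<close>, hence has
  norm at least \<open>p\<close>, and every other coordinate is smaller by a factor of at least \<open>p\<close>. As a partial
  quotient differs from its coordinate by at most \<open>1 / p\<close>, the partial quotients inherit this; being
  constant, they pass it back to the coordinates at time \<open>0\<close>, where no step precedes.
\<close>

lemma period_one_dominant:
  fixes \<alpha> :: "nat \<Rightarrow> 'p::prime_card padic"
  assumes odd: "odd CARD('p)" and per: "jp_purely_periodic m \<alpha> 1" and m: "m \<ge> 1"
  defines "A \<equiv> padic_abs CARD('p) (jp_partial_quotient m \<alpha> 0 1)"
  shows "A \<ge> real CARD('p)"
    and "padic_norm (jp_homogeneous m \<alpha> n 1) = A"
    and "1 < i \<Longrightarrow> i \<le> m \<Longrightarrow> padic_abs CARD('p) (jp_partial_quotient m \<alpha> 0 i) < A"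
    and "1 \<le> i \<Longrightarrow> i \<le> Suc m \<Longrightarrow> padic_norm (jp_homogeneous m \<alpha> n i) \<le> A"
proof -
  define p where "p = real CARD('p)"
  define w where "w = jp_homogeneous m \<alpha>"
  define a where "a i = (of_rat (jp_partial_quotient m \<alpha> 0 i) :: 'p padic)" for i
  have A: "A = padic_norm (a 1)"
    by (simp add: A_def a_def padic_norm_of_rat)
  have p: "p > 1"
    using prime_gt_1_nat[OF prime_card[where 'a = 'p]] by (simp add: p_def)
  hence p_inv: "1 / p < 1"
    by simp
  have near: "padic_norm (w n i - a i) \<le> 1 / p" if "1 \<le> i" "i \<le> m" for n i
    unfolding w_def a_def p_def by (rule period_one_norm_diff[OF odd per that])
  have nz: "w (Suc n) 1 \<noteq> 0" for n
    unfolding w_def by (rule period_one_recurrence(1)[OF per m])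
  have rec: "w n i - a i = w (Suc n) (Suc i) / w (Suc n) 1" if "1 \<le> i" "i \<le> m" for n i
    using period_one_recurrence(2)[OF per m that, of n] by (simp add: w_def a_def)
  have w_last: "w n (Suc m) = 1" for n
    by (simp add: w_def jp_homogeneous_def)
  have w_large: "padic_norm (w (Suc n) 1) \<ge> p" for n
  proof -
    have "1 / padic_norm (w (Suc n) 1) \<le> 1 / p"
      using near[of m n] m rec[of m n]
      by (simp add: w_last padic_norm_divide)
    thus ?thesis
      using p nz[of n] padic_norm_nonneg[of "w (Suc n) 1"]
      by (simp add: field_simps order_less_le)
  qed
  have a_near: "padic_norm (a i) \<le> max (padic_norm (w n i)) (1 / p)" if "1 \<le> i" "i \<le> m" for n i
    using padic_norm_diff[of "w n i" "w n i - a i"] near[OF that, of n] by auto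
  have w_near: "padic_norm (w n i) \<le> max (padic_norm (a i)) (1 / p)" if "1 \<le> i" "i \<le> m" for n i
    using padic_norm_add[of "a i" "w n i - a i"] near[OF that, of n] by auto
  have "p \<le> max (padic_norm (a 1)) (1 / p)"
    using w_near[of 1 "Suc 0"] w_large[of 0] m by (intro order.trans[OF w_large[of 0]]) simp
  thus A_ge: "A \<ge> real CARD('p)"
    using p p_inv unfolding A p_def[symmetric] by linarith
  hence A_gt: "A > 1 / p"
    using p p_inv unfolding p_def by linarith
  have w1: "padic_norm (w n 1) = A" for n
    using w_near[of 1 n] a_near[of 1 n] m A_gt unfolding A by auto
  show "padic_norm (jp_homogeneous m \<alpha> n 1) = A"
    using w1 by (simp add: w_def)
  have a_less: "padic_norm (a i) < A" if "1 < i" "i \<le> m" for i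
  proof -
    obtain j where j: "i = Suc j" "1 \<le> j" "j \<le> m"
      using \<open>1 < i\<close> \<open>i \<le> m\<close> by (cases i) auto
    have "padic_norm (w (Suc 0) i) / A \<le> 1 / p"
      using near[OF j(2,3), of 0] by (simp only: rec[OF j(2,3)] padic_norm_divide w1 j(1))
    moreover have A_pos: "A > 0"
      using A_ge p by (simp add: p_def)
    ultimately have "padic_norm (w (Suc 0) i) \<le> 1 / p * A"
      by (simp add: pos_divide_le_eq)
    also have "\<dots> < 1 * A"
      using p_inv A_pos by (intro mult_strict_right_mono)
    finally have "padic_norm (w (Suc 0) i) < A"
      by simp
    thus ?thesis
      using a_near[of i "Suc 0"] that A_gt by auto
  qed
  thus "1 < i \<Longrightarrow> i \<le> m \<Longrightarrow> padic_abs CARD('p) (jp_partial_quotient m \<alpha> 0 i) < A"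
    by (simp add: a_def padic_norm_of_rat)
  assume i: "1 \<le> i" "i \<le> Suc m"
  show "padic_norm (jp_homogeneous m \<alpha> n i) \<le> A"
  proof (cases "i = Suc m")
    case True
    thus ?thesis
      using w_last[of n] A_ge p by (simp add: w_def p_def)
  next
    case False
    hence "padic_norm (a i) \<le> A"
      using a_less[of i] i by (cases "i = 1") (auto simp: A)
    thus ?thesis
      using w_near[of i n] i False A_gt by (auto simp: w_def)
  qed
qed

text \<open>
  Two consecutive points have the same partial quotients, so their distance is at most \<open>1 / p\<close> at every
  time. The inverse step divides by a first coordinate of norm at least \<open>p\<close> and therefore shrinks
  distances by a factor \<open>p\<close>; going back from time \<open>n + k\<close> to time \<open>n\<close> applies it \<open>k\<close> times.
\<close>

lemma period_one_contraction:
  fixes \<alpha> :: "nat \<Rightarrow> 'p::prime_card padic"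
  assumes odd: "odd CARD('p)" and per: "jp_purely_periodic m \<alpha> 1" and m: "m \<ge> 1"
    and i: "1 \<le> i" "i \<le> Suc m"
  shows "padic_norm (jp_homogeneous m \<alpha> n i - jp_homogeneous m \<alpha> (Suc n) i)
    \<le> (1 / real CARD('p)) ^ k"
  using i
proof (induction k arbitrary: n i)
  case 0
  show ?case
  proof (cases "i = Suc m")
    case False
    define a where "a = (of_rat (jp_partial_quotient m \<alpha> 0 i) :: 'p padic)"
    have "jp_homogeneous m \<alpha> n i - jp_homogeneous m \<alpha> (Suc n) i
        = (jp_homogeneous m \<alpha> n i - a) - (jp_homogeneous m \<alpha> (Suc n) i - a)"
      by simp
    also have "padic_norm \<dots> \<le> 1 / real CARD('p)"
      by (rule order.trans[OF padic_norm_diff], rule max.boundedI; unfold a_def,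
          rule period_one_norm_diff[OF odd per]) (use 0 False in simp_all)
    also have "\<dots> \<le> 1"
      using prime_gt_1_nat[OF prime_card[where 'a = 'p]] by simp
    finally show ?thesis
      by simp
  qed (simp add: jp_homogeneous_def)
next
  case (Suc k)
  define c where "c = (1 / real CARD('p)) ^ k"
  define A where "A = padic_abs CARD('p) (jp_partial_quotient m \<alpha> 0 1)"
  show ?case
  proof (cases "i = Suc m")
    case False
    hence i: "1 \<le> i" "i \<le> m"
      using Suc.prems by auto
    note dom = period_one_dominant[OF odd per m, folded A_def]
    have p: "real CARD('p) > 0"
      by simp
    have A: "A > 0"
      using dom(1) p by linarith
    define x x' y y' where xy: "x = jp_homogeneous m \<alpha> (Suc n) 1"
      "x' = jp_homogeneous m \<alpha> (Suc (Suc n)) 1" "y = jp_homogeneous m \<alpha> (Suc n) (Suc i)"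
      "y' = jp_homogeneous m \<alpha> (Suc (Suc n)) (Suc i)"
    have nz: "x \<noteq> 0" "x' \<noteq> 0"
      unfolding xy by (rule period_one_recurrence(1)[OF per m])+
    have norms: "padic_norm x = A" "padic_norm x' = A" "padic_norm y' \<le> A"
      unfolding xy using i by (auto intro!: dom simp del: One_nat_def)
    have IH: "padic_norm (y - y') \<le> c" "padic_norm (x - x') \<le> c"
      unfolding xy c_def using i by (auto intro!: Suc.IH simp del: One_nat_def)
    have "jp_homogeneous m \<alpha> n i - jp_homogeneous m \<alpha> (Suc n) i = y / x - y' / x'"
      using period_one_recurrence(2)[OF per m i] by (simp add: xy)
    also have "\<dots> = (y - y') / x - (y' / x') * ((x - x') / x)"
      using nz by (simp add: field_simps)
    also have "padic_norm \<dots> \<le> c / A"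
    proof (intro order.trans[OF padic_norm_diff] max.boundedI)
      show "padic_norm ((y - y') / x) \<le> c / A"
        using IH A by (simp add: padic_norm_divide norms divide_right_mono)
      have "padic_norm (y' / x') * padic_norm ((x - x') / x) \<le> 1 * (c / A)"
        using IH A norms by (intro mult_mono) (auto simp: padic_norm_divide divide_right_mono)
      thus "padic_norm (y' / x' * ((x - x') / x)) \<le> c / A"
        by (simp only: padic_norm_mult mult_1)
    qed
    also have "\<dots> \<le> c / real CARD('p)"
      using dom(1) p by (intro divide_left_mono) (auto simp: c_def intro: mult_pos_pos A)
    finally show ?thesis
      by (simp add: c_def)
  qed (simp add: jp_homogeneous_def)
qed

text \<open>
  The period of the partial quotients lifts to the complete quotients, since the expansion determines
  its input.
\<close>

lemma period_one_fixed_point: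
  fixes \<alpha> :: "nat \<Rightarrow> 'p::prime_card padic"
  assumes odd: "odd CARD('p)" and per: "jp_purely_periodic m \<alpha> 1" and m: "m \<ge> 1"
    and i: "1 \<le> i" "i \<le> Suc m"
  shows "jp_homogeneous m \<alpha> (Suc 0) i = jp_homogeneous m \<alpha> 0 i"
proof -
  define d where "d = padic_norm (jp_homogeneous m \<alpha> 0 i - jp_homogeneous m \<alpha> (Suc 0) i)"
  have "(\<lambda>k. (1 / real CARD('p)) ^ k) \<longlonglongrightarrow> 0"
    using prime_gt_1_nat[OF prime_card[where 'a = 'p]] by (intro LIMSEQ_power_zero) simp
  hence "d \<le> 0"
    unfolding d_def using period_one_contraction[OF odd per m i]
    by (intro LIMSEQ_le_const) blast+
  hence "d = 0"
    unfolding d_def by (intro order.antisym) simp_all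
  thus ?thesis
    by (simp add: d_def)
qed

section \<open>Roots of the characteristic polynomial\<close>

lemma period_one_no_rational_root:
  fixes \<alpha> :: "nat \<Rightarrow> 'p::prime_card padic"
  assumes odd: "odd CARD('p)" and per: "jp_purely_periodic m \<alpha> 1" and m: "m \<ge> 1"
  shows "poly (jp_char_poly m \<alpha>) r \<noteq> 0"
proof
  define p where "p = CARD('p)"
  define a where "a = jp_partial_quotient m \<alpha> 0"
  have p: "prime p"
    by (simp add: p_def prime_card)
  have "p \<ge> 2"
    using prime_ge_2_nat[OF p] .
  hence p2: "(of_nat p :: rat) \<ge> 2"
    by (metis of_nat_le_iff of_nat_numeral)
  have bound: "2 * \<bar>a i\<bar> \<le> of_nat p" for i
    using browkin_s_bound[OF odd] by (auto simp: a_def jp_partial_quotient_def p_def less_imp_le)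
  have denom: "\<exists>n. of_nat p ^ n * a i \<in> \<int>" for i
    using browkin_s_denominator[OF odd] by (simp add: a_def jp_partial_quotient_def p_def)
  assume "poly (jp_char_poly m \<alpha>) r = 0"
  hence root: "r * horner a r m = 1"
    using char_poly_jp_matrix_root_iff[of m a r] by (simp add: jp_char_poly_def a_def)
  then obtain s t where st: "\<bar>r\<bar> = of_nat p ^ s / of_nat p ^ t"
    using horner_rational_root[OF p _ root] denom by blast
  consider "s = t" | "s > t" | "s < t"
    by linarith
  thus False
  proof cases
    case 1
    hence "r = 1 \<or> r = - 1"
      using st p2 by (auto simp: abs_if split: if_splits)
    hence "padic_abs p r = 1"
      using padic_abs_1[OF p] padic_abs_minus[OF p, of 1] by auto
    moreover have "padic_abs p (a 1) > 1"
      using period_one_dominant(1)[OF odd per m] prime_gt_1_nat[OF p] by (simp add: a_def p_def)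
    moreover have "padic_abs p (a i) < padic_abs p (a 1)" if "1 < i" "i \<le> m" for i
      using period_one_dominant(3)[OF odd per m that] by (simp add: a_def p_def)
    ultimately show False
      using horner_no_padic_unit_root[OF p m] root by blast
  next
    case 2
    hence "(of_nat p :: rat) ^ Suc t \<le> of_nat p ^ s"
      using p2 by (intro power_increasing) auto
    hence "\<bar>r\<bar> \<ge> of_nat p"
      using p2 by (simp add: st field_simps)
    thus False
      using horner_no_large_root[where a = a, OF p2 bound] root by blast
  next
    case 3
    hence "(of_nat p :: rat) ^ Suc s \<le> of_nat p ^ t"
      using p2 by (intro power_increasing) auto
    hence "of_nat p * \<bar>r\<bar> \<le> 1"
      using p2 by (simp add: st field_simps)
    thus False
      using horner_no_small_root[where a = a, OF p2 bound] root by blast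
  qed
qed

lemma period_one_fixed_point_equation:
  fixes \<alpha> :: "nat \<Rightarrow> 'p::prime_card padic"
  assumes odd: "odd CARD('p)" and per: "jp_purely_periodic m \<alpha> 1" and m: "m \<ge> 1"
  shows "\<alpha> 1 \<noteq> 0"
    and "1 \<le> i \<Longrightarrow> i \<le> m \<Longrightarrow> jp_homogeneous m \<alpha> 0 (Suc i)
      = \<alpha> 1 * (\<alpha> i - of_rat (jp_partial_quotient m \<alpha> 0 i))"
proof -
  have w: "jp_homogeneous m \<alpha> 0 i = \<alpha> i" if "i \<le> m" for i
    using that by (simp add: jp_homogeneous_def jp_complete_quotient_def)
  have w1: "jp_homogeneous m \<alpha> (Suc 0) 1 = \<alpha> 1"
    using period_one_fixed_point[OF odd per m, of 1] w[of 1] m by simp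
  thus nz: "\<alpha> 1 \<noteq> 0"
    using period_one_recurrence(1)[OF per m, of 0] by metis
  assume i: "1 \<le> i" "i \<le> m"
  have "jp_homogeneous m \<alpha> (Suc 0) (Suc i) = jp_homogeneous m \<alpha> 0 (Suc i)"
    using i by (intro period_one_fixed_point[OF odd per m]) auto
  hence "\<alpha> i = of_rat (jp_partial_quotient m \<alpha> 0 i) + jp_homogeneous m \<alpha> 0 (Suc i) / \<alpha> 1"
    using period_one_recurrence(2)[OF per m i, of 0] w[OF i(2)] w1 by metis
  thus "jp_homogeneous m \<alpha> 0 (Suc i) = \<alpha> 1 * (\<alpha> i - of_rat (jp_partial_quotient m \<alpha> 0 i))"
    using nz by simp
qed

text \<open>
  With the fixed point equations, the Horner scheme at \<open>\<alpha> 1\<close> runs through the homogeneous coordinates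
  divided by \<open>\<alpha> 1\<close>, the last of which is \<open>1 / \<alpha> 1\<close>.
\<close>

lemma period_one_root:
  fixes \<alpha> :: "nat \<Rightarrow> 'p::prime_card padic"
  assumes odd: "odd CARD('p)" and per: "jp_purely_periodic m \<alpha> 1" and m: "m \<ge> 1"
  shows "rat_eval (\<alpha> 1) (jp_char_poly m \<alpha>) = 0"
proof -
  define h where "h = horner (\<lambda>i. of_rat (jp_partial_quotient m \<alpha> 0 i)) (\<alpha> 1)"
  note fixed = period_one_fixed_point_equation[OF odd per m]
  have w: "jp_homogeneous m \<alpha> 0 i = \<alpha> i" if "i \<le> m" for i
    using that by (simp add: jp_homogeneous_def jp_complete_quotient_def)
  have "\<alpha> 1 * h i = jp_homogeneous m \<alpha> 0 (Suc i)" if "i \<le> m" for i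
    using that
  proof (induction i)
    case 0
    show ?case
      using w[of 1] m by (simp add: h_def)
  next
    case (Suc i)
    hence "\<alpha> 1 * h i = \<alpha> (Suc i)"
      using w[of "Suc i"] by simp
    hence "h (Suc i) = \<alpha> (Suc i) - of_rat (jp_partial_quotient m \<alpha> 0 (Suc i))"
      by (simp add: h_def)
    thus ?case
      using fixed(2)[of "Suc i"] Suc.prems by simp
  qed
  from this[of m] have "\<alpha> 1 * h m = 1"
    by (simp add: jp_homogeneous_def)
  thus ?thesis
    unfolding rat_eval_def jp_char_poly_def char_poly_jp_matrix_root_iff h_def .
qed

theorem proposition11:
  fixes m :: nat and \<alpha> :: "nat \<Rightarrow> 'p::prime_card padic"
  assumes "odd CARD('p)"
    and "m \<ge> 1"
    and "jp_purely_periodic m \<alpha> 1"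
  shows "\<not> (\<exists>r::rat. poly (jp_char_poly m \<alpha>) r = 0) \<and>
    (m = 2 \<longrightarrow> irreducible (jp_char_poly m \<alpha>) \<and> rat_degree (rat_adjoin {\<alpha> 1, \<alpha> 2}) = 3)"
proof (intro conjI impI)
  show no_root: "\<not> (\<exists>r::rat. poly (jp_char_poly m \<alpha>) r = 0)"
    using period_one_no_rational_root[OF assms(1,3,2)] by blast
  assume m: "m = 2"
  have deg: "degree (jp_char_poly m \<alpha>) = 3"
    using degree_monic_char_poly[OF jp_matrix_carrier] by (simp add: jp_char_poly_def m)
  show irr: "irreducible (jp_char_poly m \<alpha>)"
    using no_root by (intro irreducible_cubicI[OF deg]) blast
  have root: "rat_eval (\<alpha> 1) (jp_char_poly m \<alpha>) = 0"
    by (rule period_one_root[OF assms(1,3,2)])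
  have "\<alpha> 2 = \<alpha> 1 * (\<alpha> 1 - of_rat (jp_partial_quotient m \<alpha> 0 1))"
    using period_one_fixed_point_equation(2)[OF assms(1,3,2), of 1]
    by (simp add: m jp_homogeneous_def jp_complete_quotient_def numeral_2_eq_2)
  also have "\<dots> = rat_eval (\<alpha> 1) [:0, - jp_partial_quotient m \<alpha> 0 1, 1:]"
    by (simp add: rat_eval_pCons of_rat_minus algebra_simps)
  finally have "\<alpha> 2 \<in> rat_adjoin {\<alpha> 1}"
    unfolding rat_adjoin_algebraic[OF irr root] by simp
  hence "rat_adjoin {\<alpha> 1, \<alpha> 2} = rat_adjoin {\<alpha> 1}"
    unfolding rat_adjoin_def insert_commute[of "\<alpha> 1"] by (rule hull_redundant)
  thus "rat_degree (rat_adjoin {\<alpha> 1, \<alpha> 2}) = 3"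
    using rat_degree_adjoin_algebraic[OF irr root] deg by simp
qed

end
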